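(* Let $a>b\ge 2$ be integers and let $F=P_a\cup P_b$ be the vertex-disjoint union of a path on $a$ vertices and a path on $b$ vertices. Let $G_F(n)$ be the $n$-vertex graph consisting of a set $U$ of $\lfloor a/2\rfloor+\lfloor b/2\rfloor-1$ universal vertices (each adjacent to all other vertices), where the graph $G_F(n)-U$ on the remaining $n-|U|$ vertices consists of a single edge plus isolated vertices if both $a$ and $b$ are odd, and has no edges otherwise. Let $G$ be any $F$-free graph on $n$ vertices with $n\ge \binom{a}{\lfloor a/2\rfloor}^2a^4b^4$. Then $e(G)\le e(G_F(n))$, with equality only when $G\cong G_F(n)$.
   Context: $P_m$ denotes the path on $m$ vertices; $e(G)$ denotes the number of edges of $G$. A graph is $F$-free if it does not contain $F$ as a subgraph. *)

theory Defs
  imports Main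
begin

definition simple_graph :: "'a set \<Rightarrow> 'a set set \<Rightarrow> bool" where
  "simple_graph V E \<longleftrightarrow> finite V \<and>
     (\<forall>e\<in>E. \<exists>x y. x \<in> V \<and> y \<in> V \<and> x \<noteq> y \<and> e = {x, y})"

definition contains_subgraph :: "'b set \<Rightarrow> 'b set set \<Rightarrow> 'a set \<Rightarrow> 'a set set \<Rightarrow> bool" where
  "contains_subgraph VH EH V E \<longleftrightarrow>
     (\<exists>f. inj_on f VH \<and> f ` VH \<subseteq> V \<and> (\<forall>e\<in>EH. f ` e \<in> E))"

definition two_paths_V :: "nat \<Rightarrow> nat \<Rightarrow> nat set" where
  "two_paths_V a b = {0..<a+b}"

definition two_paths_E :: "nat \<Rightarrow> nat \<Rightarrow> nat set set" where
  "two_paths_E a b = {{i, Suc i} | i. Suc i < a} \<union> {{a + i, a + Suc i} | i. Suc i < b}"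

definition GF_V :: "nat \<Rightarrow> nat set" where
  "GF_V n = {0..<n}"

definition GF_E :: "nat \<Rightarrow> nat \<Rightarrow> nat \<Rightarrow> nat set set" where
  "GF_E a b n = (let k = a div 2 + b div 2 - 1 in
     {{x, y} | x y. x < n \<and> y < n \<and> x \<noteq> y \<and>
        (x < k \<or> y < k \<or> (odd a \<and> odd b \<and> x = k \<and> y = Suc k))})"

definition graph_iso :: "'a set \<Rightarrow> 'a set set \<Rightarrow> 'b set \<Rightarrow> 'b set set \<Rightarrow> bool" where
  "graph_iso V E W D \<longleftrightarrow>
     (\<exists>f. bij_betw f V W \<and> (\<forall>x\<in>V. \<forall>y\<in>V. {x, y} \<in> E \<longleftrightarrow> {f x, f y} \<in> D))"

end

theory Submission
  imports Defs "HOL.Binomial_Plus" "HOL-Library.FuncSet"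
begin

text \<open>
  Let \<open>k = a div 2 + b div 2 - 1\<close> and suppose that \<open>G\<close> has at least as many edges as
  \<open>G\<^sub>F(n)\<close>. The heart of the proof is to find a set \<open>U\<close> of \<open>k\<close> vertices with many common
  neighbours. First pass to a large vertex set \<open>S\<close> inside which all degrees are at least \<open>k\<close>. By the
  Erdos--Gallai theorem \<open>S\<close> spans a path on \<open>a\<close> vertices, and the rest of \<open>S\<close> contains no path on
  \<open>b\<close> vertices, hence has few edges; so many vertices have \<open>a div 2\<close> neighbours on the path, and by
  pigeonhole some \<open>a div 2\<close> of its vertices, forming a set \<open>A\<close>, have a large common neighbourhood
  \<open>X\<close>. In \<open>S - A\<close>, where degrees are at least \<open>b div 2 - 1\<close>, there are two disjoint paths starting
  in \<open>X\<close> with \<open>b - 1\<close> vertices in total. A vertex of \<open>A\<close> joins them to a path on \<open>b\<close> vertices, and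
  if two disjoint edges at \<open>X\<close> were left over, then together with the rest of \<open>A\<close> they would give a
  path on \<open>a\<close> vertices. So almost every vertex of \<open>X\<close> has all its neighbours in \<open>S - A\<close> among at
  most \<open>b + 1\<close> vertices, and a second pigeonhole extends \<open>A\<close> to \<open>U\<close>.

  Given \<open>U\<close>, a path off \<open>U\<close> with an end adjacent to \<open>U\<close> can be prolonged through \<open>U\<close> and its
  common neighbours. If \<open>a\<close> or \<open>b\<close> is even, this already excludes an edge; otherwise it excludes a
  path on three vertices, and an edge joined to all of \<open>U\<close> excludes every other edge adjacent to
  \<open>U\<close>. The vertices off \<open>U\<close> that have neighbours there but none in \<open>U\<close> account on average for fewer
  than \<open>k\<close> edges each.
\<close>

section \<open>Finite sets\<close>

lemma obtain_disjoint_subsets: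
  assumes "m + n \<le> card A" "finite A"
  obtains B C where "B \<subseteq> A" "C \<subseteq> A" "B \<inter> C = {}" "card B = m" "card C = n"
proof -
  obtain B where B: "B \<subseteq> A" "card B = m" "finite B"
    using obtain_subset_with_card_n[of m A] assms by auto
  have "n \<le> card (A - B)" using B assms by (simp add: card_Diff_subset)
  then obtain C where "C \<subseteq> A - B" "card C = n" using obtain_subset_with_card_n by metis
  then show thesis using that[of B C] B by blast
qed

lemma obtain_disjoint_subsets_with:
  assumes "finite A" "u \<in> A" "1 \<le> m" "m + n \<le> card A"
  obtains B C where "B \<subseteq> A" "card B = m" "u \<in> B" "C \<subseteq> A" "card C = n" "B \<inter> C = {}"
proof -
  have "(m - 1) + n \<le> card (A - {u})" using assms by simp
  then obtain B C where B: "B \<subseteq> A - {u}" "card B = m - 1"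
    and C: "C \<subseteq> A - {u}" "card C = n" "B \<inter> C = {}"
    using assms(1) by (rule obtain_disjoint_subsets[OF _ finite_Diff]) blast
  have "finite B" "u \<notin> B" using B(1) assms(1) by (auto intro: finite_subset)
  then have "card (insert u B) = m" using B(2) assms(3) by simp
  then show thesis using that[of "insert u B" C] B C assms(2) by blast
qed

lemma obtain_two_elements:
  assumes "2 \<le> card A"
  obtains x y where "x \<in> A" "y \<in> A" "x \<noteq> y"
proof -
  obtain B where "B \<subseteq> A" "card B = 2" using obtain_subset_with_card_n assms by metis
  then show thesis using that by (auto simp: card_2_iff)
qed

lemma card_no_consecutive:
  assumes "I \<subseteq> {p..<q}" "\<And>i. i \<in> I \<Longrightarrow> Suc i \<notin> I" "I \<noteq> {}"
  shows "2 * card I + p \<le> Suc q"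
proof -
  have "finite I" using assms(1) finite_subset by blast
  moreover have "I \<inter> Suc ` I = {}" using assms(2) by auto
  ultimately have "card (I \<union> Suc ` I) = 2 * card I" by (simp add: card_Un_disjoint card_image)
  moreover have "card (I \<union> Suc ` I) \<le> card {p..q}"
    using assms(1) by (intro card_mono) force+
  moreover have "p \<le> q" using assms(1,3) by fastforce
  ultimately show ?thesis by simp
qed

lemma bij_betw_with_parts:
  assumes fin: "finite V" "finite V'"
    and card: "card V = card V'" "card U = card U'" "card D = card D'"
    and sub: "U \<subseteq> V" "D \<subseteq> V - U" "U' \<subseteq> V'" "D' \<subseteq> V' - U'"
  obtains f where "bij_betw f V V'" "f ` U = U'" "f ` D = D'"
proof -
  have finite_parts: "finite U" "finite D" "finite U'" "finite D'"
    using fin sub by (meson finite_Diff finite_subset)+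
  then have "card (V - U - D) = card (V' - U' - D')"
    using fin card sub by (simp add: card_Diff_subset)
  then obtain f g h where f: "bij_betw f U U'" and g: "bij_betw g D D'"
    and h: "bij_betw h (V - U - D) (V' - U' - D')"
    using finite_same_card_bij finite_parts fin card by (metis finite_Diff)
  define fgh where "fgh x = (if x \<in> U then f x else if x \<in> D then g x else h x)" for x
  have "bij_betw fgh (U \<union> (D \<union> (V - U - D))) (U' \<union> (D' \<union> (V' - U' - D')))"
    unfolding fgh_def using f g h sub by (intro bij_betw_disjoint_Un) auto
  moreover have "U \<union> (D \<union> (V - U - D)) = V" "U' \<union> (D' \<union> (V' - U' - D')) = V'" using sub by auto
  moreover have "fgh ` U = f ` U" by (rule image_cong) (simp_all add: fgh_def)
  moreover have "fgh ` D = g ` D" by (rule image_cong) (use sub in \<open>auto simp: fgh_def\<close>)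
  ultimately show thesis using that f g by (simp add: bij_betw_def)
qed

section \<open>Degrees and edge counts\<close>

locale sgraph =
  fixes E :: "'a set set"
  assumes card_edge: "e \<in> E \<Longrightarrow> card e = 2"
begin

definition adj :: "'a \<Rightarrow> 'a \<Rightarrow> bool" where
  "adj x y \<longleftrightarrow> {x, y} \<in> E"

definition nbhd :: "'a set \<Rightarrow> 'a \<Rightarrow> 'a set" where
  "nbhd S x = {y \<in> S. adj x y}"

abbreviation deg :: "'a set \<Rightarrow> 'a \<Rightarrow> nat" where
  "deg S x \<equiv> card (nbhd S x)"

definition edges_in :: "'a set \<Rightarrow> 'a set set" where
  "edges_in S = {e \<in> E. e \<subseteq> S}"

definition joined :: "'a set \<Rightarrow> 'a set \<Rightarrow> bool" where
  "joined S T \<longleftrightarrow> (\<forall>x\<in>S. \<forall>y\<in>T. adj x y)"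

lemma adj_commute: "adj x y \<longleftrightarrow> adj y x"
  by (simp add: adj_def insert_commute)

lemma adj_sym: "adj x y \<Longrightarrow> adj y x"
  by (simp add: adj_commute)

lemma adj_irrefl [simp]: "\<not> adj x x"
  using card_edge[of "{x}"] by (auto simp: adj_def)

lemma mem_nbhd [simp]: "y \<in> nbhd S x \<longleftrightarrow> y \<in> S \<and> adj x y"
  by (simp add: nbhd_def)

lemma nbhd_subset: "nbhd S x \<subseteq> S"
  by auto

lemma finite_nbhd [simp]: "finite S \<Longrightarrow> finite (nbhd S x)"
  by (simp add: nbhd_def)

lemma deg_le_card: "finite S \<Longrightarrow> deg S x \<le> card S"
  by (simp add: card_mono nbhd_subset)

lemma deg_mono: "finite T \<Longrightarrow> nbhd S x \<subseteq> nbhd T x \<Longrightarrow> deg S x \<le> deg T x"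
  by (simp add: card_mono)

lemma deg_eq_card_iff:
  assumes "finite S"
  shows "deg S x = card S \<longleftrightarrow> (\<forall>y\<in>S. adj x y)"
proof -
  have "deg S x = card S \<longleftrightarrow> nbhd S x = S" by (auto dest: card_subset_eq[OF assms nbhd_subset])
  then show ?thesis by (auto simp: nbhd_def)
qed

lemma deg_le_deg_Diff:
  assumes "finite S" "finite A"
  shows "deg S x \<le> deg (S - A) x + card A"
proof -
  have "nbhd S x \<subseteq> nbhd (S - A) x \<union> A" by auto
  then have "deg S x \<le> card (nbhd (S - A) x \<union> A)" using assms by (intro card_mono) auto
  also have "\<dots> \<le> deg (S - A) x + card A" by (rule card_Un_le)
  finally show ?thesis .
qed

lemma joined_mono: "joined S T \<Longrightarrow> S' \<subseteq> S \<Longrightarrow> T' \<subseteq> T \<Longrightarrow> joined S' T'"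
  unfolding joined_def by blast

lemma joined_disjoint: "joined S T \<Longrightarrow> S \<inter> T = {}"
  unfolding joined_def by (meson adj_irrefl disjoint_iff)

lemma sum_deg_le:
  assumes "finite T"
  shows "(\<Sum>x\<in>S. deg T x) \<le> card T * card S"
  using sum_bounded_above[of S "deg T" "card T"] deg_le_card[OF assms] by (simp add: mult.commute)

lemma sum_deg_eq_iff:
  assumes "finite S" "finite T"
  shows "(\<Sum>x\<in>S. deg T x) = card T * card S \<longleftrightarrow> joined S T"
proof
  assume "(\<Sum>x\<in>S. deg T x) = card T * card S"
  then have "(\<Sum>x\<in>S. deg T x) = (\<Sum>x\<in>S. card T)" by simp
  then have "deg T x = card T" if "x \<in> S" for x
    using sum_mono_inv[of "deg T" S "\<lambda>_. card T" x] deg_le_card assms that by blast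
  then show "joined S T" using assms by (simp add: deg_eq_card_iff joined_def)
next
  assume "joined S T"
  then have "deg T x = card T" if "x \<in> S" for x
    using that assms by (simp add: deg_eq_card_iff joined_def)
  then show "(\<Sum>x\<in>S. deg T x) = card T * card S" by simp
qed

lemma sum_deg_le_by_threshold:
  assumes "finite S" "finite T"
  shows "(\<Sum>x\<in>S. deg T x) \<le> card T * card {x \<in> S. m \<le> deg T x} + (m - 1) * card S"
proof -
  have "(\<Sum>x\<in>S. deg T x) \<le> (\<Sum>x\<in>S. (if m \<le> deg T x then card T else 0) + (m - 1))"
  proof (rule sum_mono)
    fix x
    show "deg T x \<le> (if m \<le> deg T x then card T else 0) + (m - 1)"
      using deg_le_card[OF assms(2), of x] by auto
  qed
  also have "\<dots> = card T * card {x \<in> S. m \<le> deg T x} + (m - 1) * card S"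
    using assms by (simp add: sum.distrib sum.If_cases Collect_conj_eq mult.commute)
  finally show ?thesis .
qed

lemma mem_edges_in: "{x, y} \<in> edges_in S \<longleftrightarrow> x \<in> S \<and> y \<in> S \<and> adj x y"
  by (auto simp: edges_in_def adj_def)

lemma edges_inE:
  assumes "e \<in> edges_in S"
  obtains x y where "e = {x, y}" "x \<in> S" "y \<in> S" "adj x y"
proof -
  have "card e = 2" using assms card_edge by (simp add: edges_in_def)
  then obtain x y where "e = {x, y}" by (auto simp: card_2_iff)
  then show thesis using that assms mem_edges_in by blast
qed

lemma edges_in_subset_pairs: "edges_in S \<subseteq> {e. e \<subseteq> S \<and> card e = 2}"
  using card_edge by (auto simp: edges_in_def)

lemma finite_edges_in [simp]: "finite S \<Longrightarrow> finite (edges_in S)"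
  by (rule finite_subset[of _ "Pow S"]) (auto simp: edges_in_def)

lemma edges_in_empty [simp]: "edges_in {} = {}"
  using edges_in_subset_pairs[of "{}"] by auto

lemma edges_in_mono: "S \<subseteq> T \<Longrightarrow> edges_in S \<subseteq> edges_in T"
  by (auto simp: edges_in_def)

lemma card_edges_in_insert:
  assumes "finite S" "x \<notin> S"
  shows "card (edges_in (insert x S)) = card (edges_in S) + deg S x"
proof -
  have "edges_in (insert x S) = edges_in S \<union> (\<lambda>y. {x, y}) ` nbhd S x"
  proof (intro equalityI subsetI)
    fix e assume "e \<in> edges_in (insert x S)"
    then obtain y z where e: "e = {y, z}" "y \<in> insert x S" "z \<in> insert x S" "adj y z"
      by (rule edges_inE)
    then consider "y = x" "z \<in> S" | "z = x" "y \<in> S" | "y \<in> S" "z \<in> S" by auto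
    then show "e \<in> edges_in S \<union> (\<lambda>y. {x, y}) ` nbhd S x"
      using e by cases (auto simp: mem_edges_in adj_commute)
  next
    fix e assume "e \<in> edges_in S \<union> (\<lambda>y. {x, y}) ` nbhd S x"
    then show "e \<in> edges_in (insert x S)"
      using edges_in_mono[of S "insert x S"] by (auto simp: mem_edges_in)
  qed
  moreover have "edges_in S \<inter> (\<lambda>y. {x, y}) ` nbhd S x = {}"
    using assms(2) by (auto simp: mem_edges_in)
  moreover have "inj_on (\<lambda>y. {x, y}) (nbhd S x)" by (auto simp: inj_on_def doubleton_eq_iff)
  ultimately show ?thesis using assms(1) by (simp add: card_Un_disjoint card_image)
qed

lemma card_edges_in_remove:
  assumes "finite S" "x \<in> S"
  shows "card (edges_in S) = card (edges_in (S - {x})) + deg S x"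
proof -
  have "nbhd (S - {x}) x = nbhd S x" by auto
  then show ?thesis
    using card_edges_in_insert[of "S - {x}" x] assms by (simp add: insert_absorb)
qed

lemma card_edges_in_Un:
  assumes "finite S" "finite T" "S \<inter> T = {}"
  shows "card (edges_in (S \<union> T)) = card (edges_in S) + card (edges_in T) + (\<Sum>x\<in>T. deg S x)"
  using assms(2,3)
proof (induction T rule: finite_induct)
  case empty
  then show ?case by simp
next
  case (insert x T)
  have "nbhd (S \<union> T) x = nbhd S x \<union> nbhd T x" "nbhd S x \<inter> nbhd T x = {}"
    using insert.prems by auto
  then have "deg (S \<union> T) x = deg S x + deg T x"
    using assms(1) insert.hyps by (simp add: card_Un_disjoint)
  moreover have "card (edges_in (S \<union> insert x T)) = card (edges_in (S \<union> T)) + deg (S \<union> T) x"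
    using card_edges_in_insert[of "S \<union> T" x] assms(1) insert by simp
  ultimately show ?case
    using insert card_edges_in_insert[of T x] by simp
qed

lemma card_edges_in_le_choose:
  assumes "finite S"
  shows "card (edges_in S) \<le> card S choose 2"
  using card_mono[OF _ edges_in_subset_pairs[of S]] assms by (simp add: n_subsets)

lemma card_edges_in_eq_choose_iff:
  assumes "finite S"
  shows "card (edges_in S) = card S choose 2 \<longleftrightarrow> (\<forall>x\<in>S. \<forall>y\<in>S. x \<noteq> y \<longrightarrow> adj x y)"
proof -
  let ?pairs = "{e. e \<subseteq> S \<and> card e = 2}"
  have "card (edges_in S) = card S choose 2 \<longleftrightarrow> edges_in S = ?pairs"
    using card_subset_eq[OF _ edges_in_subset_pairs[of S]] assms by (auto simp: n_subsets)
  also have "\<dots> \<longleftrightarrow> ?pairs \<subseteq> edges_in S" using edges_in_subset_pairs[of S] by blast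
  also have "?pairs = (\<Union>x\<in>S. \<Union>y\<in>S - {x}. {{x, y}})" by (auto simp: card_2_iff)
  also have "\<dots> \<subseteq> edges_in S \<longleftrightarrow> (\<forall>x\<in>S. \<forall>y\<in>S. x \<noteq> y \<longrightarrow> adj x y)"
    by (auto simp: UN_subset_iff mem_edges_in)
  finally show ?thesis .
qed

lemma double_card_edges_in_le:
  assumes "finite S"
  shows "2 * card (edges_in S) \<le> card S * (card S - 1)"
  using card_edges_in_le_choose[OF assms] by (simp add: choose_two)

lemma obtain_single_edge:
  assumes "finite S" "card (edges_in S) \<le> 1"
  obtains D where "D \<subseteq> S" "card D = 2 * card (edges_in S)"
    "\<And>x y. x \<in> S \<Longrightarrow> y \<in> S \<Longrightarrow> adj x y \<longleftrightarrow> {x, y} = D"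
proof (cases "edges_in S = {}")
  case True
  then show thesis using that[of "{}"] mem_edges_in[of _ _ S] by simp
next
  case False
  then have "card (edges_in S) = 1" using assms by (simp add: le_Suc_eq)
  then obtain D where D: "edges_in S = {D}" by (auto simp: card_1_singleton_iff)
  then have "adj x y \<longleftrightarrow> {x, y} = D" if "x \<in> S" "y \<in> S" for x y
    using that mem_edges_in[of x y S] by simp
  then show thesis using that[of D] D edges_in_subset_pairs[of S] by auto
qed

lemma card_edges_in_single_edge:
  assumes "finite S" "D \<subseteq> S" "card D = 2 * m" "m \<le> 1"
    and adj: "\<And>x y. x \<in> S \<Longrightarrow> y \<in> S \<Longrightarrow> adj x y \<longleftrightarrow> {x, y} = D"
  shows "card (edges_in S) = m"
proof -
  have "e = D" if e: "e \<in> edges_in S" for e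
    using e by (rule edges_inE) (simp add: adj)
  then have sub: "edges_in S \<subseteq> {D}" by blast
  show ?thesis
  proof (cases "m = 0")
    case True
    then have "D = {}" using assms(1-3) by (simp add: finite_subset)
    then have "edges_in S = {}" using sub edges_in_subset_pairs[of S] by fastforce
    then show ?thesis using True by simp
  next
    case False
    then have "card D = 2" "m = 1" using assms(3,4) by auto
    then obtain x y where "D = {x, y}" by (auto simp: card_2_iff)
    then have "D \<in> edges_in S" using adj[of x y] assms(2) mem_edges_in[of x y S] by auto
    then have "edges_in S = {D}" using sub by blast
    then show ?thesis using \<open>m = 1\<close> by simp
  qed
qed

lemma exists_dense_core:
  assumes "finite V"
  shows "\<exists>S\<subseteq>V. (\<forall>x\<in>S. d \<le> deg S x) \<and>
    card (edges_in V) + (d - 1) * card S \<le> card (edges_in S) + (d - 1) * card V"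
  using assms
proof (induction V rule: finite_psubset_induct)
  case (psubset V)
  show ?case
  proof (cases "\<forall>x\<in>V. d \<le> deg V x")
    case True
    then show ?thesis by blast
  next
    case False
    then obtain x where x: "x \<in> V" "deg V x \<le> d - 1" by force
    then have "V - {x} \<subset> V" by blast
    from psubset.IH[OF this] obtain S where S: "S \<subseteq> V - {x}" "\<forall>y\<in>S. d \<le> deg S y"
      "card (edges_in (V - {x})) + (d - 1) * card S \<le> card (edges_in S) + (d - 1) * card (V - {x})"
      by blast
    have "(d - 1) * card V = (d - 1) * card (V - {x}) + (d - 1)"
      using card.remove[OF psubset.hyps x(1)] by simp
    then show ?thesis
      using S x card_edges_in_remove[OF psubset.hyps x(1)] by (intro exI[of _ S]) auto
  qed
qed

lemma common_neighbours:
  assumes "finite Y" "finite P" "Y \<noteq> {}" and deg: "\<And>y. y \<in> Y \<Longrightarrow> m \<le> deg P y"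
  obtains A X where "A \<subseteq> P" "card A = m" "X \<subseteq> Y" "joined A X" "card Y \<le> (card P choose m) * card X"
proof -
  have "\<exists>A. A \<subseteq> nbhd P y \<and> card A = m" if "y \<in> Y" for y
    using obtain_subset_with_card_n[OF deg[OF that]] by metis
  then obtain f where f: "f y \<subseteq> nbhd P y" "card (f y) = m" if "y \<in> Y" for y by metis
  define F where "F = {A. A \<subseteq> P \<and> card A = m}"
  have F: "finite F" "card F = card P choose m" using assms(2) by (auto simp: F_def n_subsets)
  have fF: "f \<in> Y \<rightarrow> F" using f nbhd_subset unfolding F_def by blast
  then have "F \<noteq> {}" using assms(3) by blast
  then obtain A where A: "A \<in> F" "card Y \<le> card (f -` {A} \<inter> Y) * card F"
    using pigeonhole_card[OF fF assms(1) F(1)] by blast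
  have "joined A (f -` {A} \<inter> Y)" using f adj_sym unfolding joined_def by fastforce
  then show thesis using that[of A "f -` {A} \<inter> Y"] A F(2) by (simp add: F_def mult.commute)
qed

lemma meeting_edges_cover:
  assumes meet: "\<And>x y x' y'. \<lbrakk>x \<in> X; y \<in> H; adj x y; x' \<in> X; y' \<in> H; adj x' y'\<rbrakk>
    \<Longrightarrow> {x, y} \<inter> {x', y'} \<noteq> {}"
  obtains Y where "finite Y" "card Y \<le> 2" "Y \<subseteq> X \<union> H" "\<And>x. x \<in> X - Y \<Longrightarrow> nbhd H x \<subseteq> Y"
proof (cases "\<exists>x\<in>X. \<exists>y\<in>H. adj x y")
  case True
  then obtain x y where xy: "x \<in> X" "y \<in> H" "adj x y" by blast
  have "nbhd H x' \<subseteq> {x, y}" if "x' \<in> X - {x, y}" for x'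
    using meet[OF xy, of x'] that by fastforce
  moreover have "card {x, y} \<le> 2" by (simp add: card_insert_if)
  ultimately show thesis using that[of "{x, y}"] xy by blast
next
  case False
  then have "nbhd H x = {}" if "x \<in> X" for x using that by auto
  then show thesis using that[of "{}"] by auto
qed

section \<open>Paths and the Erdos--Gallai theorem\<close>

definition path :: "'a list \<Rightarrow> bool" where
  "path xs \<longleftrightarrow> xs \<noteq> [] \<and> distinct xs \<and> successively adj xs"

abbreviation path_in :: "'a set \<Rightarrow> 'a list \<Rightarrow> bool" where
  "path_in S xs \<equiv> path xs \<and> set xs \<subseteq> S"

definition path_from :: "'a set \<Rightarrow> 'a set \<Rightarrow> 'a list \<Rightarrow> bool" where
  "path_from X S xs \<longleftrightarrow> path_in S xs \<and> hd xs \<in> X"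

definition longest_path_from :: "'a set \<Rightarrow> 'a set \<Rightarrow> 'a list \<Rightarrow> bool" where
  "longest_path_from X S v \<longleftrightarrow>
    path_from X S v \<and> (\<forall>xs. path_from X S xs \<longrightarrow> length xs \<le> length v)"

definition path_free :: "nat \<Rightarrow> 'a set \<Rightarrow> bool" where
  "path_free m S \<longleftrightarrow> (\<forall>xs. path_in S xs \<longrightarrow> length xs < m)"

lemma path_nonempty: "path xs \<Longrightarrow> xs \<noteq> []"
  by (simp add: path_def)

lemma path_distinct: "path xs \<Longrightarrow> distinct xs"
  by (simp add: path_def)

lemma path_single [simp]: "path [x]"
  by (simp add: path_def)

lemma path_append:
  assumes "xs \<noteq> []" "ys \<noteq> []"
  shows "path (xs @ ys) \<longleftrightarrow> path xs \<and> path ys \<and> set xs \<inter> set ys = {} \<and> adj (last xs) (hd ys)"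
  using assms by (auto simp: path_def successively_append_iff)

lemma path_Cons:
  "ys \<noteq> [] \<Longrightarrow> path (x # ys) \<longleftrightarrow> path ys \<and> x \<notin> set ys \<and> adj x (hd ys)"
  using path_append[of "[x]" ys] by auto

lemma path_rev [simp]: "path (rev xs) \<longleftrightarrow> path xs"
proof -
  have "(\<lambda>x y. adj y x) = adj" using adj_commute by blast
  then have "successively (\<lambda>x y. adj y x) xs = successively adj xs" by (rule arg_cong)
  then show ?thesis by (simp add: path_def)
qed

lemma path_split:
  assumes "path xs" "0 < n" "n < length xs"
  shows "path (take n xs)" "path (drop n xs)" "set (take n xs) \<inter> set (drop n xs) = {}"
  using path_append[of "take n xs" "drop n xs"] path_nonempty[OF assms(1)] assms by auto

lemma path_take: "path xs \<Longrightarrow> 0 < n \<Longrightarrow> path (take n xs)"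
  using path_split(1)[of xs n] by (cases "n < length xs") auto

lemma path_drop: "path xs \<Longrightarrow> n < length xs \<Longrightarrow> path (drop n xs)"
  using path_split(2)[of xs n] by (cases "n = 0") auto

lemma path_nth_adj: "path xs \<Longrightarrow> Suc i < length xs \<Longrightarrow> adj (xs ! i) (xs ! Suc i)"
  by (auto simp: path_def successively_conv_nth)

lemma path_length_le_card: "finite S \<Longrightarrow> path_in S xs \<Longrightarrow> length xs \<le> card S"
  using card_mono[of S "set xs"] distinct_card[of xs] by (simp add: path_def)

lemma path_free_subset: "path_free m S \<Longrightarrow> T \<subseteq> S \<Longrightarrow> path_free m T"
  unfolding path_free_def by blast

lemma not_path_freeE:
  assumes "\<not> path_free m S" "0 < m"
  obtains xs where "path_in S xs" "length xs = m"
proof -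
  obtain xs where "path_in S xs" "m \<le> length xs"
    using assms(1) by (auto simp: path_free_def not_less)
  then show thesis using that[of "take m xs"] set_take_subset[of m xs] path_take assms(2) by auto
qed

lemma path_from_take: "path_from X S xs \<Longrightarrow> 0 < n \<Longrightarrow> path_from X S (take n xs)"
  using set_take_subset[of n xs] by (auto simp: path_from_def path_take)

lemma longest_path_fromD: "longest_path_from X S v \<Longrightarrow> path_from X S xs \<Longrightarrow> length xs \<le> length v"
  by (simp add: longest_path_from_def)

lemma exists_longest_path_from:
  assumes "finite S" "x \<in> X" "x \<in> S"
  obtains v where "longest_path_from X S v"
proof -
  have "path_from X S [x]" using assms by (simp add: path_from_def)
  moreover have "\<forall>xs. path_from X S xs \<longrightarrow> length xs < Suc (card S)"
    using path_length_le_card[OF assms(1)] by (auto simp: path_from_def less_Suc_eq_le)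
  ultimately show thesis
    using ex_has_greatest_nat[of "path_from X S" "[x]" length] that
    unfolding longest_path_from_def by blast
qed

lemma nbhd_last_subset:
  assumes "longest_path_from X S v"
  shows "nbhd S (last v) \<subseteq> set v"
proof (rule ccontr)
  assume "\<not> ?thesis"
  then obtain z where "z \<in> nbhd S (last v)" "z \<notin> set v" by blast
  then have z: "z \<in> S" "adj (last v) z" "z \<notin> set v" by auto
  have "path_from X S v" using assms by (simp add: longest_path_from_def)
  then have "path_from X S (v @ [z])"
    using z path_nonempty[of v] by (auto simp: path_from_def path_append)
  then show False using longest_path_fromD[OF assms] by fastforce
qed

lemma longest_path_rev:
  assumes "longest_path_from S S v"
  shows "longest_path_from S S (rev v)"
proof -
  have "path_from S S v" using assms by (simp add: longest_path_from_def)
  then have "path_from S S (rev v)"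
    using path_nonempty[of v] last_in_set[of v] by (auto simp: path_from_def hd_rev)
  then show ?thesis using assms by (simp add: longest_path_from_def)
qed

lemma deg_set_eq_card_indices:
  assumes "distinct xs"
  shows "deg (set xs) y = card {i. i < length xs \<and> adj y (xs ! i)}"
proof -
  have "nbhd (set xs) y = (!) xs ` {i. i < length xs \<and> adj y (xs ! i)}"
    by (auto simp: in_set_conv_nth)
  then show ?thesis using assms by (simp add: card_image inj_on_nth)
qed

lemma crossing_chords:
  assumes v: "path v" and deg: "length v \<le> deg (set v) (hd v) + deg (set v) (last v)"
  obtains i where "Suc i < length v" "adj (hd v) (v ! Suc i)" "adj (last v) (v ! i)"
proof -
  let ?l = "length v"
  define I where "I = {i. Suc i < ?l \<and> adj (hd v) (v ! Suc i)}"
  define J where "J = {i. i < ?l \<and> adj (last v) (v ! i)}"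
  have "v \<noteq> []" using v by (rule path_nonempty)
  have "{j. j < ?l \<and> adj (hd v) (v ! j)} = Suc ` I"
  proof (intro equalityI subsetI)
    fix j assume j: "j \<in> {j. j < ?l \<and> adj (hd v) (v ! j)}"
    then have "j \<noteq> 0" using \<open>v \<noteq> []\<close> hd_conv_nth[of v] by (intro notI) auto
    then show "j \<in> Suc ` I" using j by (cases j) (auto simp: I_def)
  qed (auto simp: I_def)
  then have I: "deg (set v) (hd v) = card I"
    using deg_set_eq_card_indices[OF path_distinct[OF v]] by (simp add: card_image)
  have J: "deg (set v) (last v) = card J"
    unfolding J_def by (rule deg_set_eq_card_indices[OF path_distinct[OF v]])
  have "i < ?l - 1" if "i \<in> J" for i
  proof -
    have "i \<noteq> ?l - 1" using that \<open>v \<noteq> []\<close> last_conv_nth[of v] by (intro notI) (auto simp: J_def)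
    then show ?thesis using that by (auto simp: J_def)
  qed
  then have sub: "I \<union> J \<subseteq> {..<?l - 1}" by (auto simp: I_def)
  have "I \<inter> J \<noteq> {}"
  proof
    assume "I \<inter> J = {}"
    then have "card I + card J = card (I \<union> J)"
      using sub by (metis card_Un_disjoint finite_Un finite_lessThan finite_subset)
    also have "\<dots> \<le> ?l - 1" using card_mono[OF _ sub] by simp
    finally show False using deg \<open>v \<noteq> []\<close> unfolding I J by (cases v) auto
  qed
  then show thesis using that by (auto simp: I_def J_def)
qed

lemma closed_path_of_crossing_chords:
  assumes v: "path v" and i: "Suc i < length v" "adj (hd v) (v ! Suc i)" "adj (last v) (v ! i)"
  obtains c where "path c" "set c = set v" "adj (last c) (hd c)"
proof -
  let ?c = "take (Suc i) v @ rev (drop (Suc i) v)"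
  have ends: "hd (take (Suc i) v) = hd v" "last (take (Suc i) v) = v ! i"
    "hd (drop (Suc i) v) = v ! Suc i"
    using i(1) by (simp add: hd_take, simp add: take_Suc_conv_app_nth, simp add: hd_drop_conv_nth)
  have "path ?c"
    using path_split[OF v, of "Suc i"] i ends
    by (subst path_append) (auto simp: hd_rev adj_commute)
  moreover have "set ?c = set v" by (metis append_take_drop_id set_append set_rev)
  moreover have "adj (last ?c) (hd ?c)"
    using i ends by (cases v) (auto simp: last_rev adj_commute)
  ultimately show thesis by (rule that)
qed

lemma closed_path_rotate:
  assumes "path c" "adj (last c) (hd c)" "y \<in> set c"
  obtains d where "path d" "set d = set c" "hd d = y"
proof -
  obtain c1 c2 where c: "c = c1 @ y # c2" using assms(3) by (metis split_list)
  have "path ((y # c2) @ c1)"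
    using assms(1,2) path_append[of c1 "y # c2"] path_append[of "y # c2" c1] unfolding c
    by (cases "c1 = []") auto
  then show thesis using that[of "(y # c2) @ c1"] by (auto simp: c)
qed

text \<open>The path closes up to a cycle, and an edge leaving the cycle would open it to a longer path.\<close>

lemma longest_path_isolated:
  assumes v: "longest_path_from S S v" and deg: "length v \<le> deg S (hd v) + deg S (last v)"
    and z: "z \<in> S - set v"
  shows "nbhd (set v) z = {}"
proof (rule ccontr)
  assume "nbhd (set v) z \<noteq> {}"
  then obtain y where y: "y \<in> set v" "adj z y" by auto
  have path: "path v" "set v \<subseteq> S" using v by (auto simp: longest_path_from_def path_from_def)
  have "nbhd S (last v) \<subseteq> set v" "nbhd S (hd v) \<subseteq> set v"
    using nbhd_last_subset[OF v] nbhd_last_subset[OF longest_path_rev[OF v]]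
    by (simp_all add: last_rev)
  then have "nbhd S (last v) \<subseteq> nbhd (set v) (last v)" "nbhd S (hd v) \<subseteq> nbhd (set v) (hd v)"
    by auto
  then have "length v \<le> deg (set v) (hd v) + deg (set v) (last v)"
    using deg deg_mono[of "set v"] by (meson add_mono finite_set le_trans)
  then obtain i where i: "Suc i < length v" "adj (hd v) (v ! Suc i)" "adj (last v) (v ! i)"
    using crossing_chords path(1) by blast
  obtain c where c: "path c" "set c = set v" "adj (last c) (hd c)"
    using closed_path_of_crossing_chords[OF path(1) i] .
  obtain d where d: "path d" "set d = set v" "hd d = y"
    using closed_path_rotate[OF c(1,3), of y] c(2) y(1) by auto
  have "path (z # d)"
    using path_Cons[of d z] path_nonempty[OF d(1)] d y(2) z by simp
  then have "path_from S S (z # d)" using d(2) z path(2) by (auto simp: path_from_def)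
  then have "length (z # d) \<le> length v" by (rule longest_path_fromD[OF v])
  then show False
    using d path distinct_card[of d] distinct_card[of v] by (simp add: path_def)
qed

lemma path_free_sparse_piece:
  assumes fin: "finite S" and free: "path_free m S" and "S \<noteq> {}"
  obtains C where "C \<subseteq> S" "C \<noteq> {}"
    "2 * card (edges_in S) \<le> 2 * card (edges_in (S - C)) + (m - 2) * card C"
proof (cases "\<exists>x\<in>S. 2 * deg S x \<le> m - 2")
  case True
  then obtain x where x: "x \<in> S" "2 * deg S x \<le> m - 2" by blast
  then show thesis using that[of "{x}"] card_edges_in_remove[OF fin x(1)] by auto
next
  case False
  then have deg: "m - 1 \<le> 2 * deg S x" if "x \<in> S" for x using that by (force simp: not_le)
  obtain v where v: "longest_path_from S S v"
    using assms exists_longest_path_from by blast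
  then have path: "path_in S v" by (auto simp: longest_path_from_def path_from_def)
  then have short: "length v < m" using free by (simp add: path_free_def)
  have "hd v \<in> S" "last v \<in> S" using path path_nonempty by auto
  then have "length v \<le> deg S (hd v) + deg S (last v)"
    using short deg[of "hd v"] deg[of "last v"] by linarith
  then have "nbhd (set v) z = {}" if "z \<in> S - set v" for z
    using longest_path_isolated[OF v _ that] by blast
  then have "(\<Sum>z\<in>S - set v. deg (set v) z) = 0" by simp
  moreover have "set v \<union> (S - set v) = S" using path by blast
  ultimately have split: "card (edges_in S) = card (edges_in (set v)) + card (edges_in (S - set v))"
    using card_edges_in_Un[of "set v" "S - set v"] fin by simp
  have "2 * card (edges_in (set v)) \<le> card (set v) * (card (set v) - 1)"
    by (rule double_card_edges_in_le) simp
  also have "\<dots> \<le> card (set v) * (m - 2)"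
    using short card_length[of v] by (intro mult_le_mono2) linarith
  finally show thesis
    using that[of "set v"] path path_nonempty split by (simp add: mult.commute)
qed

theorem Erdos_Gallai:
  assumes "finite S" "path_free m S"
  shows "2 * card (edges_in S) \<le> (m - 2) * card S"
  using assms
proof (induction S rule: finite_psubset_induct)
  case (psubset S)
  show ?case
  proof (cases "S = {}")
    case True
    then show ?thesis by simp
  next
    case False
    then obtain C where C: "C \<subseteq> S" "C \<noteq> {}"
      "2 * card (edges_in S) \<le> 2 * card (edges_in (S - C)) + (m - 2) * card C"
      using path_free_sparse_piece[OF psubset.hyps psubset.prems] by blast
    have "2 * card (edges_in (S - C)) \<le> (m - 2) * card (S - C)"
      using C psubset.prems by (intro psubset.IH) (auto intro: path_free_subset)
    then have "2 * card (edges_in S) \<le> (m - 2) * (card (S - C) + card C)"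
      using C(3) by (simp add: distrib_left)
    also have "card (S - C) + card C = card S"
      using C(1) psubset.hyps
      by (metis card_Diff_subset card_mono finite_subset le_add_diff_inverse2)
    finally show ?thesis .
  qed
qed

section \<open>Disjoint paths\<close>

lemma alternating_path:
  assumes "finite T" "finite X" "joined T X" "u \<in> T" "card T \<le> Suc (card X)"
  obtains r where "path_in (T \<union> X) r" "hd r = u" "last r \<in> T" "Suc (length r) = 2 * card T"
proof -
  have "\<exists>r. path_in (T \<union> X) r \<and> hd r = u \<and> last r \<in> T \<and> Suc (length r) = 2 * card T"
    using assms
  proof (induction "card T" arbitrary: T X u)
    case 0
    then show ?case by auto
  next
    case (Suc t)
    show ?case
    proof (cases "T = {u}")
      case True
      then show ?thesis by (intro exI[of _ "[u]"]) auto
    next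
      case False
      then obtain u' where u': "u' \<in> T - {u}" using Suc.prems(4) by blast
      have card_T: "card T = Suc (card (T - {u}))" by (rule card.remove[OF Suc.prems(1,4)])
      have "0 < card (T - {u})" using u' Suc.prems(1) by (auto simp: card_gt_0_iff)
      then obtain x where x: "x \<in> X" using card_T Suc.prems(5) by fastforce
      have "card (T - {u}) \<le> Suc (card (X - {x}))"
        using card.remove[OF Suc.prems(2) x] card_T Suc.prems(5) by linarith
      then obtain r where r: "path_in ((T - {u}) \<union> (X - {x})) r" "hd r = u'" "last r \<in> T - {u}"
        "Suc (length r) = 2 * card (T - {u})"
        using Suc.hyps(1)[of "T - {u}" "X - {x}" u'] Suc.hyps(2) Suc.prems(1-3) u' card_T
        by (auto intro: joined_mono)
      have "adj u x" "adj x u'" "u \<noteq> x"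
        using Suc.prems(3,4) x u' joined_disjoint[of T X] by (auto simp: joined_def adj_commute)
      moreover have "x \<notin> T" "u \<notin> X" using x Suc.prems(3,4) joined_disjoint by blast+
      ultimately have "path (u # x # r)"
        using r path_nonempty[of r] by (auto simp: path_Cons)
      moreover have "Suc (length (u # x # r)) = 2 * card T" using r(4) unfolding card_T by simp
      moreover have "set (u # x # r) \<subseteq> T \<union> X" using r(1) x Suc.prems(4) by auto
      moreover have "last (u # x # r) \<in> T" using r(1,3) path_nonempty[of r] by simp
      ultimately show ?thesis by (metis list.sel(1))
    qed
  qed
  then show thesis using that by blast
qed

lemma linked_path:
  assumes TX: "finite T" "finite X" "joined T X" "card T \<le> Suc (card X)"
    and p: "path p" and q: "path q" and "set p \<inter> set q = {}" "(set p \<union> set q) \<inter> (T \<union> X) = {}"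
    and u: "u \<in> T" "adj (last p) u" and "joined T {hd q}"
  obtains r where "path_in (set p \<union> set q \<union> T \<union> X) r"
    "Suc (length r) = length p + length q + 2 * card T"
proof -
  obtain r where r: "path_in (T \<union> X) r" "hd r = u" "last r \<in> T" "Suc (length r) = 2 * card T"
    using alternating_path[OF TX(1-3) u(1) TX(4)] .
  have "set p \<inter> set r = {}" "set q \<inter> set r = {}" using r(1) assms(8) by blast+
  moreover have "adj (last r) (hd q)" using r(3) assms(11) by (simp add: joined_def)
  ultimately have "path (p @ r @ q)"
    using path_append[of p "r @ q"] path_append[of r q] r p q u(2) assms(7)
      p[THEN path_nonempty] q[THEN path_nonempty] path_nonempty[of r] by auto
  then show thesis using that[of "p @ r @ q"] r by auto
qed

lemma two_linked_paths:
  assumes UX: "finite U" "finite X" "joined U X"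
    and paths: "path p" "path q" "path p'" "path q'"
    and distinct: "distinct (p @ q @ p' @ q')" and off: "set (p @ q @ p' @ q') \<inter> U = {}"
    and u: "u \<in> U" "adj (last p) u" and ends: "joined U {hd q, last p', hd q'}"
    and t: "1 \<le> t" "1 \<le> t'" "t + t' \<le> card U"
    and large: "length (p @ q @ p' @ q') + t + t' \<le> card X"
  obtains r r' where "path_in (U \<union> X \<union> set (p @ q)) r" "path_in (U \<union> X \<union> set (p' @ q')) r'"
    "set r \<inter> set r' = {}" "Suc (length r) = length p + length q + 2 * t"
    "Suc (length r') = length p' + length q' + 2 * t'"
proof -
  let ?L = "set (p @ q @ p' @ q')"
  obtain T T' where T: "T \<subseteq> U" "card T = t" "u \<in> T"
    and T': "T' \<subseteq> U" "card T' = t'" and TT': "T \<inter> T' = {}"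
    using obtain_disjoint_subsets_with UX(1) u(1) t(1,3) .
  have fin: "finite T" "finite T'" using T(1) T'(1) UX(1) finite_subset by auto
  have "card X - card ?L \<le> card (X - ?L)" by (rule diff_card_le_card_Diff) simp
  then have "t + t' \<le> card (X - ?L)" using large card_length[of "p @ q @ p' @ q'"] by linarith
  then obtain Y Y' where Y: "Y \<subseteq> X - ?L" "card Y = t" and Y': "Y' \<subseteq> X - ?L" "card Y' = t'"
    and YY': "Y \<inter> Y' = {}"
    using UX(2) by (rule obtain_disjoint_subsets[OF _ finite_Diff]) blast
  have finY: "finite Y" "finite Y'" using Y Y' UX(2) by (auto intro: finite_subset)
  obtain r where r: "path_in (set p \<union> set q \<union> T \<union> Y) r"
    "Suc (length r) = length p + length q + 2 * card T"
  proof (rule linked_path[OF fin(1) finY(1) _ _ paths(1,2) _ _ T(3) u(2)])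
    show "joined T Y" "joined T {hd q}"
      using UX(3) ends T(1) Y(1) by (blast intro: joined_mono)+
    show "(set p \<union> set q) \<inter> (T \<union> Y) = {}" using off T(1) Y(1) by auto
  qed (use distinct T Y in auto)
  obtain u' where u': "u' \<in> T'" using T'(2) t(2) by fastforce
  obtain r' where r': "path_in (set p' \<union> set q' \<union> T' \<union> Y') r'"
    "Suc (length r') = length p' + length q' + 2 * card T'"
  proof (rule linked_path[OF fin(2) finY(2) _ _ paths(3,4) _ _ u'])
    show "joined T' Y'" "joined T' {hd q'}"
      using UX(3) ends T'(1) Y'(1) by (blast intro: joined_mono)+
    show "adj (last p') u'" using ends u' T'(1) by (auto simp: joined_def adj_commute)
    show "(set p' \<union> set q') \<inter> (T' \<union> Y') = {}" using off T'(1) Y'(1) by auto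
  qed (use distinct T' Y' in auto)
  have "(set p \<union> set q \<union> T \<union> Y) \<inter> (set p' \<union> set q' \<union> T' \<union> Y') = {}"
    using distinct off T(1) T'(1) TT' Y(1) Y'(1) YY' joined_disjoint[OF UX(3)] by auto
  then have "set r \<inter> set r' = {}" using r(1) r'(1) by blast
  moreover have "path_in (U \<union> X \<union> set (p @ q)) r" using r(1) T(1) Y(1) by auto
  moreover have "path_in (U \<union> X \<union> set (p' @ q')) r'" using r'(1) T'(1) Y'(1) by auto
  ultimately show thesis using that r(2) r'(2) T(2) T'(2) by simp
qed

lemma joined_path:
  assumes "finite T" "finite X" "joined T X" "0 < card T" "card T < card X"
  obtains r where "path_in (T \<union> X) r" "length r = 2 * card T + 1"
proof -
  obtain u where u: "u \<in> T" using assms(4) by fastforce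
  have "2 \<le> card X" using assms(4,5) by linarith
  then obtain x y where xy: "x \<in> X" "y \<in> X" "x \<noteq> y" by (rule obtain_two_elements)
  have TX: "T \<inter> X = {}" using assms(3) by (rule joined_disjoint)
  have card_T: "card T \<le> Suc (card (X - {x, y}))"
    using xy assms(2,5) by (simp add: card_Diff_subset)
  obtain r where r: "path_in (set [x] \<union> set [y] \<union> T \<union> (X - {x, y})) r"
    "Suc (length r) = length [x] + length [y] + 2 * card T"
  proof (rule linked_path[OF assms(1) finite_Diff[OF assms(2)] _ _ path_single path_single _ _ u])
    show "card T \<le> Suc (card (X - {x, y}))" by (rule card_T)
    show "joined T (X - {x, y})" "joined T {hd [y]}"
      using assms(3) xy by (auto intro: joined_mono)
    show "adj (last [x]) u" using assms(3) u xy by (auto simp: joined_def adj_commute)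
    show "(set [x] \<union> set [y]) \<inter> (T \<union> (X - {x, y})) = {}" using TX xy by auto
  qed (use xy in auto)
  then show thesis using that[of r] xy by auto
qed

lemma longest_path_attachment:
  assumes v: "longest_path_from X S v" and w: "path_from X (S - set v) w"
    and i: "i < length v" "adj (last w) (v ! i)"
  shows "length w \<le> i" "i + length w < length v" "Suc i < length v \<Longrightarrow> \<not> adj (last w) (v ! Suc i)"
proof -
  have pv: "path v" "set v \<subseteq> S" "hd v \<in> X"
    using v by (auto simp: longest_path_from_def path_from_def)
  have pw: "path w" "set w \<subseteq> S" "hd w \<in> X" "set w \<inter> set v = {}"
    using w by (auto simp: path_from_def)
  have nonempty: "v \<noteq> []" "w \<noteq> []" using pv(1) pw(1) path_nonempty by auto
  have last_take: "last (take (Suc i) v) = v ! i" using i(1) by (simp add: take_Suc_conv_app_nth)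
  have "path_from X S (w @ drop i v)"
    using pv pw nonempty i path_drop[OF pv(1) i(1)]
    by (auto simp: path_from_def path_append hd_drop_conv_nth dest: in_set_dropD)
  then show "length w \<le> i" using longest_path_fromD[OF v] i(1) by fastforce
  have "path_from X S (w @ rev (take (Suc i) v))"
    using pv pw nonempty i last_take path_take[OF pv(1), of "Suc i"]
    by (auto simp: path_from_def path_append hd_rev dest: in_set_takeD)
  then show "i + length w < length v" using longest_path_fromD[OF v] i(1) by fastforce
  show "\<not> adj (last w) (v ! Suc i)" if "Suc i < length v"
  proof
    assume adj: "adj (last w) (v ! Suc i)"
    have "last w \<in> set w" using nonempty by simp
    then have y: "last w \<notin> set v" "last w \<in> S" using pw by blast+
    have "path (last w # drop (Suc i) v)"
      using that adj y path_drop[OF pv(1) that]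
      by (auto simp: path_Cons hd_drop_conv_nth dest: in_set_dropD)
    then have "path_from X S (take (Suc i) v @ last w # drop (Suc i) v)"
      using path_split[OF pv(1), of "Suc i"] that pv y i last_take nonempty
      by (auto simp: path_from_def path_append hd_take adj_commute dest: in_set_takeD in_set_dropD)
    then show False using longest_path_fromD[OF v] that by fastforce
  qed
qed

text \<open>The neighbours of the last vertex of \<open>w\<close> on \<open>v\<close> stay away from both ends of \<open>v\<close> and are never
  consecutive, so that \<open>v\<close> must be long.\<close>

lemma longest_path_ge_double_degree:
  assumes v: "longest_path_from X S v" and w: "longest_path_from {x} (S - set v) w"
    and x: "x \<in> X" and deg: "d \<le> deg S (last w)" and short: "length w \<le> d"
  shows "2 * d < length v"
proof -
  let ?y = "last w"
  have pw: "path w" using w by (simp add: longest_path_from_def path_from_def)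
  have wX: "path_from X (S - set v) w"
    using w x by (auto simp: longest_path_from_def path_from_def)
  define I where "I = {i. i < length v \<and> adj ?y (v ! i)}"
  have pv: "path v" using v by (simp add: longest_path_from_def path_from_def)
  have "nbhd (S - set v) ?y \<subseteq> set w" by (rule nbhd_last_subset[OF w])
  then have "nbhd S ?y \<subseteq> nbhd (set v) ?y \<union> (set w - {?y})" by fastforce
  then have "deg S ?y \<le> card (nbhd (set v) ?y \<union> (set w - {?y}))" by (intro card_mono) auto
  also have "\<dots> \<le> deg (set v) ?y + card (set w - {?y})" by (rule card_Un_le)
  also have "deg (set v) ?y = card I"
    unfolding I_def by (rule deg_set_eq_card_indices[OF path_distinct[OF pv]])
  also have "card (set w - {?y}) = length w - 1"
    using pw path_nonempty[OF pw] by (simp add: path_def distinct_card)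
  finally have d: "Suc d \<le> card I + length w" using deg path_nonempty[OF pw] by (cases w) auto
  then have "I \<noteq> {}" using short by auto
  have bounds: "length w \<le> i" "i + length w < length v" "Suc i \<notin> I" if "i \<in> I" for i
    using longest_path_attachment[OF v wX, of i] that by (auto simp: I_def)
  have "I \<subseteq> {length w..<length v - length w}" using bounds(1,2) by fastforce
  then have "2 * card I + length w \<le> Suc (length v - length w)"
    using bounds(3) \<open>I \<noteq> {}\<close> by (rule card_no_consecutive)
  then show ?thesis using d \<open>I \<noteq> {}\<close> short by linarith
qed

lemma two_disjoint_paths_from:
  assumes fin: "finite S" and XS: "X \<subseteq> S" and deg: "\<And>x. x \<in> S \<Longrightarrow> d \<le> deg S x"
    and m: "2 \<le> m" "m \<le> 2 * d + 2" "m \<le> card X"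
  shows "\<exists>p q. path_from X S p \<and> path_from X S q \<and> set p \<inter> set q = {} \<and> length p + length q = m"
proof -
  obtain x0 where "x0 \<in> X" using m by fastforce
  then obtain v where v: "longest_path_from X S v"
    using exists_longest_path_from[OF fin] XS by blast
  then have vX: "path_from X S v" by (simp add: longest_path_from_def)
  define v' where "v' = take (m - 1) v"
  have "length v' \<le> m - 1" by (simp add: v'_def)
  then have "card (set v') < card X" using card_length[of v'] m by linarith
  then obtain x where x: "x \<in> X" "x \<notin> set v'"
    using fin XS by (meson card_mono finite_set leD subsetI)
  show ?thesis
  proof (cases "m - 1 \<le> length v")
    case True
    have "path_from X S v'" unfolding v'_def using vX m(1) by (simp add: path_from_take)
    moreover have "path_from X S [x]" using x XS by (auto simp: path_from_def)
    ultimately show ?thesis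
      using x True m(1) by (intro exI[of _ v'] exI[of _ "[x]"]) (simp add: v'_def)
  next
    case short: False
    then have "x \<in> S - set v" using x XS by (auto simp: v'_def)
    then obtain w where w: "longest_path_from {x} (S - set v) w"
      using exists_longest_path_from[of "S - set v" x "{x}"] fin by auto
    then have pw: "path_from X S w" "set w \<inter> set v = {}" "set w \<subseteq> S" "w \<noteq> []"
      using x path_nonempty by (auto simp: longest_path_from_def path_from_def)
    have "last w \<in> S" using pw(3,4) last_in_set by blast
    then have "d < length w"
      using longest_path_ge_double_degree[OF v w x(1), of d] deg short m(2) by fastforce
    moreover have "length w \<le> length v" using longest_path_fromD[OF v pw(1)] .
    ultimately have "length (take (m - Suc d) v) + length (take (Suc d) w) = m" "0 < m - Suc d"
      using short m(2) by auto
    moreover have "path_from X S (take (m - Suc d) v)" "path_from X S (take (Suc d) w)"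
      using vX pw(1) \<open>0 < m - Suc d\<close> by (auto intro: path_from_take)
    moreover have "set (take (m - Suc d) v) \<inter> set (take (Suc d) w) = {}"
      using pw(2) by (auto dest: in_set_takeD)
    ultimately show ?thesis by blast
  qed
qed

lemma contains_two_paths:
  assumes p: "path_in V p" "length p = a" and q: "path_in V q" "length q = b"
    and disjoint: "set p \<inter> set q = {}"
  shows "contains_subgraph (two_paths_V a b) (two_paths_E a b) V E"
proof -
  let ?f = "(!) (p @ q)"
  have "distinct (p @ q)" using p q disjoint by (simp add: path_def)
  then have "inj_on ?f (two_paths_V a b)"
    using p q by (intro inj_on_nth) (auto simp: two_paths_V_def)
  moreover have "?f ` two_paths_V a b \<subseteq> V"
  proof
    fix x assume "x \<in> ?f ` two_paths_V a b"
    then obtain i where "i < length (p @ q)" "x = (p @ q) ! i"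
      using p(2) q(2) by (auto simp: two_paths_V_def)
    then have "x \<in> set (p @ q)" using nth_mem by blast
    then show "x \<in> V" using p q by auto
  qed
  moreover have "?f ` e \<in> E" if "e \<in> two_paths_E a b" for e
  proof -
    from that consider i where "e = {i, Suc i}" "Suc i < a"
      | i where "e = {a + i, a + Suc i}" "Suc i < b"
      by (auto simp: two_paths_E_def)
    then show ?thesis
    proof cases
      case 1
      then show ?thesis using path_nth_adj[of p i] p by (simp add: nth_append adj_def)
    next
      case 2
      then show ?thesis using path_nth_adj[of q i] p q by (simp add: nth_append adj_def)
    qed
  qed
  ultimately show ?thesis unfolding contains_subgraph_def by blast
qed

end

section \<open>Finding the universal vertices\<close>

definition core_size :: "nat \<Rightarrow> nat \<Rightarrow> nat" where
  "core_size a b = a div 2 + b div 2 - 1"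

definition spare_edges :: "nat \<Rightarrow> nat \<Rightarrow> nat" where
  "spare_edges a b = (if odd a \<and> odd b then 1 else 0)"

definition extremal_size :: "nat \<Rightarrow> nat \<Rightarrow> nat \<Rightarrow> nat" where
  "extremal_size a b n =
    (core_size a b choose 2) + core_size a b * (n - core_size a b) + spare_edges a b"

locale two_path_free =
  fixes V :: "'a set" and E :: "'a set set" and a b :: nat
  assumes simple: "simple_graph V E"
    and two_paths_free: "\<not> contains_subgraph (two_paths_V a b) (two_paths_E a b) V E"
    and two_le_b: "2 \<le> b" and b_less_a: "b < a"
begin

sublocale sgraph E
proof
  fix e assume "e \<in> E"
  then show "card e = 2" using simple by (force simp: simple_graph_def)
qed

abbreviation "k \<equiv> core_size a b"

lemma core_size_halves: "k + 1 = a div 2 + b div 2" "1 \<le> b div 2" "b div 2 \<le> a div 2"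
  using two_le_b b_less_a by (simp_all add: core_size_def div_le_mono)

lemma core_size_bounds: "1 \<le> k" "a div 2 \<le> k" "k < a" "b - 1 \<le> k"
  using core_size_halves two_le_b b_less_a by linarith+

lemma finite_V: "finite V"
  using simple by (simp add: simple_graph_def)

lemma finite_subset_V: "S \<subseteq> V \<Longrightarrow> finite S"
  using finite_V by (rule rev_finite_subset)

lemma edges_in_V: "edges_in V = E"
  using simple by (force simp: edges_in_def simple_graph_def)

lemma no_two_disjoint_paths:
  assumes "path_in V p" "path_in V q" "set p \<inter> set q = {}" "a \<le> length p" "b \<le> length q"
  shows False
proof -
  have "path_in V (take a p)" "path_in V (take b q)"
    using assms two_le_b b_less_a by (auto intro: path_take dest: in_set_takeD)
  moreover have "set (take a p) \<inter> set (take b q) = {}"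
    using assms(3) by (auto dest: in_set_takeD)
  ultimately show False
    using contains_two_paths[of "take a p" V a "take b q" b] assms(4,5) two_paths_free by simp
qed

lemma path_free_off_path:
  assumes "path_in V p" "a \<le> length p"
  shows "path_free b (V - set p)"
  unfolding path_free_def
proof (intro allI impI)
  fix q assume "path_in (V - set p) q"
  then have "path_in V q" "set p \<inter> set q = {}" by auto
  then show "length q < b" using no_two_disjoint_paths[of p q] assms by (meson not_less)
qed

lemma no_two_linked_paths:
  assumes UV: "U \<subseteq> V" and XV: "X \<subseteq> V" and UX: "joined U X"
    and paths: "path_in (V - U) p" "path_in (V - U) q" "path_in (V - U) p'" "path_in (V - U) q'"
    and distinct: "distinct (p @ q @ p' @ q')"
    and u: "u \<in> U" "adj (last p) u" and ends: "joined U {hd q, last p', hd q'}"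
    and t: "1 \<le> t" "1 \<le> t'" "t + t' \<le> card U"
    and large: "length (p @ q @ p' @ q') + t + t' \<le> card X"
    and long: "a < length p + length q + 2 * t \<and> b < length p' + length q' + 2 * t' \<or>
      b < length p + length q + 2 * t \<and> a < length p' + length q' + 2 * t'"
  shows False
proof -
  have "set (p @ q @ p' @ q') \<inter> U = {}" using paths by auto
  then obtain r r' where r: "path_in (U \<union> X \<union> set (p @ q)) r" "path_in (U \<union> X \<union> set (p' @ q')) r'"
    "set r \<inter> set r' = {}" "Suc (length r) = length p + length q + 2 * t"
    "Suc (length r') = length p' + length q' + 2 * t'"
    using two_linked_paths[of U X p q p' q' u t t'] finite_subset_V UV XV UX paths distinct u ends t large
    by blast
  have "path_in V r" "path_in V r'" using r(1,2) UV XV paths by auto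
  moreover have "a \<le> length r \<and> b \<le> length r' \<or> b \<le> length r \<and> a \<le> length r'"
    using r(4,5) long by linarith
  ultimately show False using no_two_disjoint_paths r(3) by blast
qed

lemma path_free_sum: "S \<subseteq> V \<Longrightarrow> path_free (a + b) S"
proof (rule ccontr)
  assume S: "S \<subseteq> V" "\<not> path_free (a + b) S"
  then obtain xs where xs: "path_in S xs" "length xs = a + b"
    using two_le_b by (auto elim: not_path_freeE)
  have "path (take a xs)" "path (drop a xs)" "set (take a xs) \<inter> set (drop a xs) = {}"
    using path_split[of xs a] xs two_le_b b_less_a by auto
  moreover have "set (take a xs) \<subseteq> V" "set (drop a xs) \<subseteq> V"
    using xs(1) S(1) by (auto dest: in_set_takeD in_set_dropD)
  ultimately show False using no_two_disjoint_paths[of "take a xs" "drop a xs"] xs(2) by simp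
qed

text \<open>Removing vertices of degree below \<open>k\<close> loses fewer than \<open>k\<close> edges each, and the remaining set
  is large because it spans at most \<open>k + 1\<close> times as many edges as vertices.\<close>

lemma exists_large_dense_core:
  assumes "k * card V \<le> card E + k * k"
  obtains S where "S \<subseteq> V" "\<And>x. x \<in> S \<Longrightarrow> k \<le> deg S x"
    "k * card S \<le> card (edges_in S) + k * k" "card V \<le> 2 * card S + k * k"
proof -
  obtain S where S: "S \<subseteq> V" "\<And>x. x \<in> S \<Longrightarrow> k \<le> deg S x"
    and core: "card E + (k - 1) * card S \<le> card (edges_in S) + (k - 1) * card V"
    using exists_dense_core[OF finite_V, of k] unfolding edges_in_V by blast
  have k_mult: "k * n = (k - 1) * n + n" for n using core_size_bounds(1) by (cases k) auto
  have "card S \<le> card V" using card_mono[OF finite_V S(1)] .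
  moreover have surplus: "card V + (k - 1) * card S \<le> card (edges_in S) + k * k"
    using core assms k_mult[of "card V"] by linarith
  ultimately have "k * card S \<le> card (edges_in S) + k * k" using k_mult[of "card S"] by linarith
  moreover have "card V \<le> 2 * card S + k * k"
  proof -
    have "2 * card (edges_in S) \<le> (a + b - 2) * card S"
      by (rule Erdos_Gallai[OF finite_subset_V path_free_sum]) (rule S(1))+
    also have "\<dots> \<le> (2 * (k - 1) + 4) * card S"
      using core_size_halves by (intro mult_le_mono1) linarith
    finally have "card (edges_in S) \<le> (k - 1) * card S + 2 * card S"
      by (simp add: algebra_simps)
    then show ?thesis using surplus by linarith
  qed
  ultimately show thesis using that S by blast
qed

lemma dense_set_has_path:
  assumes S: "S \<subseteq> V" and dense: "k * card S \<le> card (edges_in S) + k * k"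
    and large: "2 * (a * a) < card S"
  obtains p where "path_in S p" "length p = a"
proof -
  have "\<not> path_free a S"
  proof
    assume "path_free a S"
    then have "2 * card (edges_in S) \<le> (a - 2) * card S"
      by (rule Erdos_Gallai[OF finite_subset_V[OF S]])
    moreover have "Suc (a - 2) * card S \<le> 2 * k * card S"
      using core_size_bounds(2) b_less_a two_le_b by (intro mult_le_mono1) linarith
    moreover have "k * k \<le> a * a" using core_size_bounds(3) by (intro mult_le_mono) auto
    ultimately show False using dense large by simp
  qed
  then show thesis using not_path_freeE that b_less_a by blast
qed

lemma many_half_attached_vertices:
  assumes S: "S \<subseteq> V" and dense: "k * card S \<le> card (edges_in S) + k * k"
    and p: "path_in S p" "length p = a"
  shows "card S \<le> a * a + 2 * (a * card {x \<in> S - set p. a div 2 \<le> deg (set p) x})"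
proof -
  define R where "R = S - set p"
  define N where "N = {x \<in> R. a div 2 \<le> deg (set p) x}"
  have finR: "finite R" using finite_subset_V[OF S] by (simp add: R_def)
  have card_p: "card (set p) = a" using p by (simp add: path_def distinct_card)
  have SR: "S = set p \<union> R" "set p \<inter> R = {}" using p(1) by (auto simp: R_def)
  have "path_free b R"
    using path_free_off_path[of p] p S by (auto simp: R_def intro: path_free_subset)
  then have edges_R: "2 * card (edges_in R) \<le> (b - 2) * card R" by (rule Erdos_Gallai[OF finR])
  have edges_p: "2 * card (edges_in (set p)) + a \<le> a * a"
  proof -
    have "2 * card (edges_in (set p)) \<le> a * (a - 1)"
      using double_card_edges_in_le[of "set p"] unfolding card_p by simp
    moreover have "a * (a - 1) + a = a * a" by (cases a) auto
    ultimately show ?thesis by linarith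
  qed
  have cross: "(\<Sum>x\<in>R. deg (set p) x) \<le> a * card N + (a div 2 - 1) * card R"
    using sum_deg_le_by_threshold[OF finR, of "set p" "a div 2"] by (simp add: card_p N_def)
  have "card (edges_in S) = card (edges_in (set p)) + card (edges_in R) + (\<Sum>x\<in>R. deg (set p) x)"
    unfolding SR(1) by (rule card_edges_in_Un[OF _ finR SR(2)]) simp
  then have "2 * (k * card S) + a
      \<le> a * a + (b - 2) * card R + 2 * (a * card N) + 2 * ((a div 2 - 1) * card R) + 2 * (k * k)"
    using dense edges_R edges_p cross by linarith
  moreover have card_S: "card S = card R + a"
    using card_Un_disjoint[of "set p" R] finR SR card_p by simp
  then have "k * card S = k * card R + k * a" by (simp add: distrib_left)
  moreover have "(b - 2) * card R + 2 * ((a div 2 - 1) * card R) + card R \<le> 2 * (k * card R)"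
  proof -
    have "((b - 2) + 2 * (a div 2 - 1) + 1) * card R \<le> (2 * k) * card R"
      using core_size_halves two_le_b by (intro mult_le_mono1) linarith
    then show ?thesis by (simp add: algebra_simps)
  qed
  moreover have "k * k \<le> k * a" using core_size_bounds(3) by simp
  ultimately show ?thesis using card_S unfolding N_def R_def by linarith
qed

lemma exists_joined_half_core:
  assumes S: "S \<subseteq> V" and dense: "k * card S \<le> card (edges_in S) + k * k"
    and large: "2 * (a * a) < card S"
  obtains A X where "A \<subseteq> S" "card A = a div 2" "X \<subseteq> S" "joined A X"
    "card S \<le> a * a + 2 * a * ((a choose (a div 2)) * card X)"
proof -
  obtain p where p: "path_in S p" "length p = a" using dense_set_has_path assms by blast
  define N where "N = {x \<in> S - set p. a div 2 \<le> deg (set p) x}"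
  have card_S: "card S \<le> a * a + 2 * (a * card N)"
    unfolding N_def by (rule many_half_attached_vertices[OF S dense p])
  have card_p: "card (set p) = a" using p by (simp add: path_def distinct_card)
  have "card N \<noteq> 0" using card_S large by (intro notI) simp
  then have N: "finite N" "N \<noteq> {}" by (auto simp: card_eq_0_iff)
  have "a div 2 \<le> deg (set p) y" if "y \<in> N" for y using that by (simp add: N_def)
  then obtain A X where AX: "A \<subseteq> set p" "card A = a div 2" "X \<subseteq> N" "joined A X"
    and card_N: "card N \<le> (a choose (a div 2)) * card X"
    using common_neighbours[OF N(1) finite_set N(2), of "a div 2" p] unfolding card_p by blast
  have "a * card N \<le> a * ((a choose (a div 2)) * card X)" using card_N by (rule mult_le_mono2)
  then have "card S \<le> a * a + 2 * a * ((a choose (a div 2)) * card X)"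
    using card_S unfolding mult.assoc by linarith
  then show thesis using that[of A X] AX p(1) by (auto simp: N_def)
qed

lemma no_two_edges_off_paths:
  assumes A: "A \<subseteq> V" "card A = a div 2" and X: "X \<subseteq> V" "joined A X" "3 * a \<le> card X"
    and pq: "path_from X (V - A) p" "path_from X (V - A) q" "length p + length q = b - 1"
    and "4 \<le> b"
    and xy: "x \<in> X" "y \<in> V - A" "adj x y" and xy': "x' \<in> X" "y' \<in> V - A" "adj x' y'"
    and distinct: "distinct (p @ q @ [x, y, x', y'])"
  shows False
proof -
  have AX: "A \<inter> X = {}" using X(2) by (rule joined_disjoint)
  have "0 < card A" using A(2) b_less_a two_le_b by linarith
  then obtain u where u: "u \<in> A" by (auto simp: card_gt_0_iff)
  have ends: "hd p \<in> X" "hd q \<in> X" using pq by (auto simp: path_from_def)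
  have paths: "path_in (V - A) (rev p)" "path_in (V - A) q"
    "path_in (V - A) [y, x]" "path_in (V - A) [x', y']"
    using pq xy xy' X(1) AX by (auto simp: path_from_def path_Cons adj_commute)
  show False
  proof (rule no_two_linked_paths[OF A(1) X(1,2) paths _ u])
    show "distinct (rev p @ q @ [y, x] @ [x', y'])" using distinct by auto
    show "adj (last (rev p)) u" using ends u X(2) by (auto simp: last_rev joined_def adj_commute)
    show "joined A {hd q, last [y, x], hd [x', y']}"
      using ends xy(1) xy'(1) X(2) by (auto simp: joined_def)
    show "1 \<le> (1::nat)" "1 \<le> a div 2 - 1" "1 + (a div 2 - 1) \<le> card A"
      using A(2) b_less_a \<open>4 \<le> b\<close> by linarith+
    show "length (rev p @ q @ [y, x] @ [x', y']) + 1 + (a div 2 - 1) \<le> card X"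
      using pq(3) X(3) b_less_a \<open>4 \<le> b\<close> by simp
    show "a < length (rev p) + length q + 2 * 1 \<and>
        b < length [y, x] + length [x', y'] + 2 * (a div 2 - 1) \<or>
      b < length (rev p) + length q + 2 * 1 \<and>
        a < length [y, x] + length [x', y'] + 2 * (a div 2 - 1)"
      using pq(3) b_less_a \<open>4 \<le> b\<close> by simp
  qed
qed

lemma deg_off_half_core:
  assumes "S \<subseteq> V" "A \<subseteq> S" "card A = a div 2" "k \<le> deg S x"
  shows "b div 2 - 1 \<le> deg (S - A) x"
proof -
  have "finite S" "finite A" using assms(1,2) finite_subset_V by auto
  then show ?thesis using deg_le_deg_Diff[of S A x] assms(3,4) core_size_halves(1) by linarith
qed

lemma exists_small_hub:
  assumes S: "S \<subseteq> V" "\<And>x. x \<in> S \<Longrightarrow> k \<le> deg S x" and A: "A \<subseteq> S" "card A = a div 2"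
    and X: "X \<subseteq> S" "joined A X" "3 * a \<le> card X" and "4 \<le> b"
  obtains P where "P \<subseteq> S - A" "card P \<le> a" "\<And>x. x \<in> X - P \<Longrightarrow> nbhd (S - A) x \<subseteq> P"
proof -
  have "finite (S - A)" using S(1) finite_subset_V by simp
  have XH: "X \<subseteq> S - A" using X(1) joined_disjoint[OF X(2)] by blast
  have "b div 2 - 1 \<le> deg (S - A) x" if "x \<in> S - A" for x
    using deg_off_half_core[OF S(1) A] S(2) that by blast
  moreover have "2 \<le> b - 1" "b - 1 \<le> 2 * (b div 2 - 1) + 2" "b - 1 \<le> card X"
    using \<open>4 \<le> b\<close> X(3) b_less_a by linarith+
  ultimately obtain p q where pq: "path_from X (S - A) p" "path_from X (S - A) q"
    "set p \<inter> set q = {}" "length p + length q = b - 1"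
    using two_disjoint_paths_from[OF \<open>finite (S - A)\<close> XH] by blast
  define Q where "Q = set p \<union> set q"
  have pqV: "path_from X (V - A) p" "path_from X (V - A) q"
    using pq(1,2) S(1) by (auto simp: path_from_def)
  have meet: "{x, y} \<inter> {x', y'} \<noteq> {}"
    if "x \<in> X - Q" "y \<in> S - A - Q" "adj x y" "x' \<in> X - Q" "y' \<in> S - A - Q" "adj x' y'" for x y x' y'
  proof
    assume disjoint: "{x, y} \<inter> {x', y'} = {}"
    have "x \<noteq> y" "x' \<noteq> y'" using that by auto
    then have "distinct (p @ q @ [x, y, x', y'])"
      using pq that disjoint by (auto simp: path_from_def path_def Q_def)
    then show False
      using no_two_edges_off_paths[OF _ A(2) _ X(2,3) pqV pq(4) \<open>4 \<le> b\<close>, of x y x' y']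
        that S(1) A(1) X(1) by blast
  qed
  obtain Y where Y: "finite Y" "card Y \<le> 2" "Y \<subseteq> (X - Q) \<union> (S - A - Q)"
    "\<And>x. x \<in> (X - Q) - Y \<Longrightarrow> nbhd (S - A - Q) x \<subseteq> Y"
    using meeting_edges_cover[of "X - Q" "S - A - Q"] meet by metis
  have "card (Q \<union> Y) \<le> card Q + card Y" by (rule card_Un_le)
  moreover have "card Q \<le> length p + length q"
    unfolding Q_def by (metis add_mono card_Un_le card_length le_trans)
  ultimately have "card (Q \<union> Y) \<le> a" using pq(4) Y(2) b_less_a two_le_b by linarith
  moreover have "Q \<union> Y \<subseteq> S - A" using pq Y(3) XH by (auto simp: Q_def path_from_def)
  moreover have "nbhd (S - A) x \<subseteq> Q \<union> Y" if "x \<in> X - (Q \<union> Y)" for x using Y(4)[of x] that by auto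
  ultimately show thesis using that by blast
qed

lemma extend_joined_half_core:
  assumes S: "S \<subseteq> V" "\<And>x. x \<in> S \<Longrightarrow> k \<le> deg S x" and A: "A \<subseteq> S" "card A = a div 2"
    and X: "X \<subseteq> S" "joined A X" "5 * a * (a choose (a div 2)) \<le> card X" and "4 \<le> b"
  obtains U X' where "U \<subseteq> V" "card U = k" "X' \<subseteq> V" "joined U X'" "4 * a \<le> card X'"
proof -
  let ?C = "a choose (a div 2)" and ?d = "b div 2 - 1"
  have C: "1 \<le> ?C" by (simp add: Suc_le_eq)
  then have "a * 1 \<le> a * ?C" by (intro mult_le_mono2)
  then have card_X: "5 * a \<le> card X" "a + 4 * a * ?C \<le> card X"
    using X(3) unfolding mult.assoc by linarith+
  then obtain P where P: "P \<subseteq> S - A" "card P \<le> a" "\<And>x. x \<in> X - P \<Longrightarrow> nbhd (S - A) x \<subseteq> P"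
    using exists_small_hub[OF S A X(1,2) _ \<open>4 \<le> b\<close>] by auto
  have "P \<subseteq> S" using P(1) by blast
  then have fin: "finite A" "finite P" "finite X"
    using finite_subset_V[OF S(1)] A(1) X(1) by (auto intro: finite_subset)
  have "card X - card P \<le> card (X - P)" using fin(2) by (rule diff_card_le_card_Diff)
  then have large: "4 * a * ?C \<le> card (X - P)" using card_X(2) P(2) by linarith
  moreover have "0 < 4 * a * ?C" using C b_less_a by simp
  ultimately have "0 < card (X - P)" by linarith
  then have "X - P \<noteq> {}" by (metis card.empty less_irrefl)
  moreover have "?d \<le> deg P x" if "x \<in> X - P" for x
  proof -
    have "?d \<le> deg (S - A) x" using deg_off_half_core[OF S(1) A] S(2) that X(1) by blast
    also have "\<dots> \<le> deg P x" using P(3)[OF that] fin(2) by (intro deg_mono) auto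
    finally show ?thesis .
  qed
  ultimately obtain B X' where B: "B \<subseteq> P" "card B = ?d" "X' \<subseteq> X - P" "joined B X'"
    and card_X': "card (X - P) \<le> (card P choose ?d) * card X'"
    using common_neighbours[of "X - P" P ?d] fin by blast
  have "card P choose ?d \<le> ?C"
    using P(2) by (meson binomial_right_mono binomial_maximum le_trans)
  then have "(card P choose ?d) * card X' \<le> ?C * card X'" by (rule mult_le_mono1)
  then have "?C * (4 * a) \<le> ?C * card X'"
    using large card_X' unfolding mult.commute[of ?C "4 * a"] by linarith
  then have "4 * a \<le> card X'" using C by simp
  moreover have "A \<inter> B = {}" "finite B" using B(1) P(1) fin(2) finite_subset by blast+
  then have "card (A \<union> B) = k"
    using A(2) B(2) fin(1) core_size_halves(2) by (simp add: card_Un_disjoint core_size_def)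
  moreover have "A \<union> B \<subseteq> V" "X' \<subseteq> V" using A(1) B(1,3) P(1) X(1) S(1) by auto
  moreover have "joined (A \<union> B) X'" using B(3,4) X(2) by (auto simp: joined_def)
  ultimately show thesis using that by blast
qed

lemma exists_joined_core:
  assumes large: "24 * (a * (a choose (a div 2)))\<^sup>2 \<le> card V"
    and dense: "k * card V \<le> card E + k * k"
  obtains U X where "U \<subseteq> V" "card U = k" "X \<subseteq> V" "joined U X" "4 * a \<le> card X"
proof -
  let ?C = "a choose (a div 2)"
  obtain S where S: "S \<subseteq> V" "\<And>x. x \<in> S \<Longrightarrow> k \<le> deg S x"
    "k * card S \<le> card (edges_in S) + k * k" "card V \<le> 2 * card S + k * k"
    using exists_large_dense_core[OF dense] by metis
  have card_V: "24 * (a * a * (?C * ?C)) \<le> card V"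
    using large by (simp add: power2_eq_square mult.assoc mult.left_commute)
  have C: "1 \<le> ?C" by (simp add: Suc_le_eq)
  then have "1 * 1 \<le> ?C * ?C" by (intro mult_le_mono)
  then have square_le: "a * a \<le> a * a * (?C * ?C)" "0 < a * a" using b_less_a by auto
  have k_square_le: "k * k \<le> a * a" using core_size_bounds(3) by (intro mult_le_mono) auto
  have "2 * (a * a) < card S" using S(4) card_V square_le k_square_le by linarith
  then obtain A X where AX: "A \<subseteq> S" "card A = a div 2" "X \<subseteq> S" "joined A X"
    and card_S: "card S \<le> a * a + 2 * a * (?C * card X)"
    using exists_joined_half_core[OF S(1,3)] by metis
  have X_large: "5 * a * ?C \<le> card X"
  proof (rule ccontr)
    assume "\<not> ?thesis"
    then have "2 * a * (?C * card X) \<le> 2 * a * (?C * (5 * a * ?C))" by (intro mult_le_mono2) simp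
    also have "\<dots> = 10 * (a * a * (?C * ?C))" by (simp add: algebra_simps)
    finally show False using card_S S(4) card_V square_le k_square_le by linarith
  qed
  show thesis
  proof (cases "4 \<le> b")
    case True
    then show thesis using extend_joined_half_core[OF S(1,2) AX X_large] that by blast
  next
    case False
    then have "b div 2 = 1" using two_le_b by auto
    then have "card A = k" using AX(2) by (simp add: core_size_def)
    moreover have "5 * a * 1 \<le> 5 * a * ?C" using C by (intro mult_le_mono2)
    then have "4 * a \<le> card X" using X_large by linarith
    ultimately show thesis using that[of A X] AX S(1) by blast
  qed
qed

end

section \<open>Counting edges off the universal vertices\<close>

text \<open>\<open>D\<close> is either empty or the only edge off \<open>U\<close>.\<close>

definition clique_join :: "'a set \<Rightarrow> 'a set set \<Rightarrow> 'a set \<Rightarrow> 'a set \<Rightarrow> bool" where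
  "clique_join V E U D \<longleftrightarrow> U \<subseteq> V \<and> D \<subseteq> V - U \<and>
    (\<forall>x\<in>V. \<forall>y\<in>V. {x, y} \<in> E \<longleftrightarrow> x \<noteq> y \<and> (x \<in> U \<or> y \<in> U \<or> {x, y} = D))"

locale two_path_free_core = two_path_free +
  fixes U X :: "'a set"
  assumes U_subset: "U \<subseteq> V" and card_U: "card U = k" and X_subset: "X \<subseteq> V"
    and joined_U_X: "joined U X" and card_X: "4 * a \<le> card X"
begin

abbreviation "W \<equiv> V - U"

definition isolated :: "'a set" where
  "isolated = {w \<in> W. nbhd W w = {}}"

definition attached :: "'a set" where
  "attached = {w \<in> W. nbhd W w \<noteq> {} \<and> nbhd U w \<noteq> {}}"

definition detached :: "'a set" where
  "detached = {w \<in> W. nbhd W w \<noteq> {} \<and> nbhd U w = {}}"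

definition full_edges :: "'a set set" where
  "full_edges = {e \<in> edges_in W. joined e U}"

lemma finite_parts [simp]:
  "finite U" "finite W" "finite isolated" "finite attached" "finite detached"
  using finite_V finite_subset_V[OF U_subset]
  by (simp_all add: isolated_def attached_def detached_def)

lemma W_parts:
  "W = isolated \<union> (attached \<union> detached)" "isolated \<inter> (attached \<union> detached) = {}"
  "attached \<inter> detached = {}"
  by (auto simp: isolated_def attached_def detached_def)

lemma nonisolatedI: "x \<in> W \<Longrightarrow> y \<in> W \<Longrightarrow> adj x y \<Longrightarrow> x \<in> attached \<union> detached"
  by (auto simp: attached_def detached_def nbhd_def)

lemma U_nonempty: "U \<noteq> {}"
  using card_U core_size_bounds(1) by auto

lemma deg_U_le: "deg U w \<le> k"
  using deg_le_card[of U w] card_U by simp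

lemma attachedE:
  assumes "w \<in> attached"
  obtains y u where "w \<in> W" "y \<in> W" "adj w y" "u \<in> U" "adj w u"
  using assms by (auto simp: attached_def nbhd_def)

lemma W_path_free: "path_free b W"
proof (rule ccontr)
  assume "\<not> path_free b W"
  then obtain q where q: "path_in W q" "length q = b"
    using two_le_b by (auto elim: not_path_freeE)
  have "card X - card (set q) \<le> card (X - set q)" by (rule diff_card_le_card_Diff) simp
  then have "card U < card (X - set q)"
    using card_X card_U q(2) card_length[of q] core_size_bounds(3) b_less_a by linarith
  moreover have "joined U (X - set q)" using joined_U_X by (rule joined_mono) auto
  moreover have "0 < card U" using card_U core_size_bounds(1) by simp
  moreover have "finite (X - set q)" using finite_subset_V[OF X_subset] by simp
  ultimately obtain r where r: "path_in (U \<union> (X - set q)) r" "length r = 2 * card U + 1"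
    using joined_path[of U "X - set q"] by auto
  have "set r \<inter> set q = {}" "path_in V r" using r(1) q(1) U_subset X_subset by auto
  moreover have "a \<le> length r" using r(2) card_U core_size_bounds(2) by linarith
  ultimately show False using no_two_disjoint_paths[of r q] q by auto
qed

lemma no_linked_short_paths:
  assumes paths: "path_in W p" "path_in W q" and disjoint: "set p \<inter> set q = {}"
    and short: "length p + length q \<le> 4"
    and u: "u \<in> U" "adj (last p) u" and hd_q: "joined U {hd q}"
    and t: "1 \<le> t" "1 \<le> t'" "t + t' \<le> k"
    and long: "a < length p + length q + 2 * t \<and> b < 2 * t' + 2 \<or>
      b < length p + length q + 2 * t \<and> a < 2 * t' + 2"
  shows False
proof -
  have "card X - card (set (p @ q)) \<le> card (X - set (p @ q))" by (rule diff_card_le_card_Diff) simp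
  then have "2 \<le> card (X - set (p @ q))"
    using card_length[of "p @ q"] short card_X b_less_a two_le_b by simp
  then obtain x y where xy: "x \<in> X - set (p @ q)" "y \<in> X - set (p @ q)" "x \<noteq> y"
    by (rule obtain_two_elements)
  then have xyW: "x \<in> W" "y \<in> W" using X_subset joined_disjoint[OF joined_U_X] by auto
  show False
  proof (rule no_two_linked_paths[OF U_subset X_subset joined_U_X paths _ _ _ u])
    show "distinct (p @ q @ [x] @ [y])" using paths disjoint xy by (auto simp: path_def)
    show "joined U {hd q, last [x], hd [y]}" using hd_q joined_U_X xy by (auto simp: joined_def)
    show "length (p @ q @ [x] @ [y]) + t + t' \<le> card X"
      using short t(3) card_X core_size_bounds(3) b_less_a two_le_b by simp
    show "path_in W [x]" "path_in W [y]" using xyW by auto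
  qed (use t card_U long in simp_all)
qed

lemma no_attached_path:
  assumes p: "path_in W p" "length p \<le> 3" and u: "u \<in> U" "adj (last p) u"
    and t: "1 \<le> t" "1 \<le> t'" "t + t' \<le> k"
    and long: "a \<le> length p + 2 * t \<and> b < 2 * t' + 2 \<or> b \<le> length p + 2 * t \<and> a < 2 * t' + 2"
  shows False
proof -
  have "card X - card (set p) \<le> card (X - set p)" by (rule diff_card_le_card_Diff) simp
  then have "2 \<le> card (X - set p)" using p(2) card_length[of p] card_X b_less_a two_le_b by linarith
  then obtain z where z: "z \<in> X - set p" by (rule obtain_two_elements)
  then have "z \<in> W" using X_subset joined_disjoint[OF joined_U_X] by auto
  then show False
    using no_linked_short_paths[OF p(1) _ _ _ u _ t, of "[z]"] z p(2) long joined_U_X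
    by (auto simp: joined_def)
qed

lemma attached_empty:
  assumes "even a \<or> even b"
  shows "attached = {}"
proof (rule ccontr)
  assume "attached \<noteq> {}"
  then obtain w where "w \<in> attached" by blast
  then obtain y u where w: "w \<in> W" "y \<in> W" "adj w y" and u: "u \<in> U" "adj w u" by (rule attachedE)
  then have p: "path_in W [y, w]" by (auto simp: path_Cons adj_commute)
  note no_path = no_attached_path[OF p _ u(1)]
  consider "even a" | "even b" "b = 2" | "even b" "b \<noteq> 2" using assms by blast
  then show False
  proof cases
    case 1
    then have "a = 2 * (a div 2)" by simp
    then have t: "1 \<le> a div 2 - 1" "a div 2 - 1 + b div 2 \<le> k" "a \<le> 2 + 2 * (a div 2 - 1)"
      "b < 2 * (b div 2) + 2"
      using core_size_halves b_less_a two_le_b by linarith+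
    show False
      by (rule no_path[OF _ _ t(1) core_size_halves(2) t(2)]) (use t(3,4) u in simp_all)
  next
    case 2
    then show False using W_path_free p by (auto simp: path_free_def)
  next
    case 3
    then have "b = 2 * (b div 2)" by simp
    then have t: "1 \<le> b div 2 - 1" "b div 2 - 1 + a div 2 \<le> k" "b \<le> 2 + 2 * (b div 2 - 1)"
      "a < 2 * (a div 2) + 2" "1 \<le> a div 2"
      using \<open>b \<noteq> 2\<close> core_size_halves b_less_a two_le_b by linarith+
    show False
      by (rule no_path[OF _ _ t(1,5,2)]) (use t(3,4) u in simp_all)
  qed
qed

lemma odd_halves:
  assumes "odd a" "odd b"
  shows "1 \<le> a div 2 - 1" "a div 2 - 1 + b div 2 \<le> k" "a \<le> 3 + 2 * (a div 2 - 1)"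
    "b < 2 * (b div 2) + 2"
  using odd_two_times_div_two_succ[OF assms(1)] odd_two_times_div_two_succ[OF assms(2)]
    core_size_halves b_less_a by linarith+

lemma no_attached_P3:
  assumes "w \<in> attached" "y \<in> W" "z \<in> W" "adj w y" "adj y z" "z \<noteq> w"
  shows False
proof -
  obtain u where u: "w \<in> W" "u \<in> U" "adj w u" using assms(1) by (rule attachedE)
  have odd: "odd a" "odd b" using attached_empty assms(1) by auto
  note t = odd_halves[OF odd]
  have "path_in W [z, y, w]" using assms u by (auto simp: path_Cons adj_commute)
  then show False
    by (rule no_attached_path[OF _ _ u(2) _ t(1) core_size_halves(2) t(2)])
      (use t(3,4) u in simp_all)
qed

lemma attached_edges_disjoint:
  assumes "e \<in> edges_in attached" "e' \<in> edges_in attached" "w \<in> e" "w \<in> e'"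
  shows "e = e'"
proof -
  have edge_at_w: "\<exists>x \<in> attached. f = {w, x} \<and> adj w x" if f: "f \<in> edges_in attached" "w \<in> f" for f
    using f(1) by (rule edges_inE) (use f(2) in \<open>auto simp: adj_commute\<close>)
  obtain x x' where x: "x \<in> attached" "e = {w, x}" "adj w x"
    and x': "x' \<in> attached" "e' = {w, x'}" "adj w x'"
    using edge_at_w assms by metis
  have "w \<in> attached" using assms(1,3) by (auto simp: edges_in_def)
  then have "w \<in> W" "x' \<in> W" using x'(1) by (auto simp: attached_def)
  then have "x' = x" using no_attached_P3[OF x(1), of w x'] x x' by (auto simp: adj_commute)
  then show ?thesis using x x' by simp
qed

lemma full_edge_eq_attached:
  assumes "e \<in> full_edges"
  shows "e = attached"
proof -
  have "e \<in> edges_in W" and full: "joined e U" using assms by (auto simp: full_edges_def)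
  then obtain x y where e: "e = {x, y}" "x \<in> W" "y \<in> W" "adj x y" by (auto elim: edges_inE)
  obtain u0 where "u0 \<in> U" using U_nonempty by blast
  then have "u0 \<in> nbhd U x" "u0 \<in> nbhd U y" "y \<in> nbhd W x" "x \<in> nbhd W y"
    using full e by (auto simp: joined_def adj_commute)
  then have sub: "e \<subseteq> attached" using e unfolding attached_def by blast
  have "w \<in> e" if w: "w \<in> attached" for w
  proof (rule ccontr)
    assume "w \<notin> e"
    have odd: "odd a" "odd b" using attached_empty w by auto
    obtain z u where z: "w \<in> W" "z \<in> W" "adj w z" and u: "u \<in> U" "adj w u"
      using w by (rule attachedE)
    note t = odd_halves[OF odd]
    have "z \<notin> e"
      using no_attached_P3[OF w z(2), of x] no_attached_P3[OF w z(2), of y] z e \<open>w \<notin> e\<close>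
      by (auto simp: adj_commute)
    then have disjoint: "set [z, w] \<inter> set [x, y] = {}" using \<open>w \<notin> e\<close> e(1) by auto
    have paths: "path_in W [z, w]" "path_in W [x, y]"
      using z e by (auto simp: path_Cons adj_commute)
    have hd_edge: "joined U {hd [x, y]}" using full e(1) by (auto simp: joined_def adj_commute)
    show False
      by (rule no_linked_short_paths
          [OF paths disjoint _ u(1) _ hd_edge t(1) core_size_halves(2) t(2)])
        (use t(3,4) u(2) in simp_all)
  qed
  then show ?thesis using sub by blast
qed

lemma card_full_edges_le: "card full_edges \<le> spare_edges a b"
proof (cases "full_edges = {}")
  case False
  then obtain e where e: "e \<in> full_edges" by blast
  then have "attached \<noteq> {}"
    using full_edge_eq_attached[OF e] card_edge by (fastforce simp: full_edges_def edges_in_def)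
  then have "spare_edges a b = 1" using attached_empty by (auto simp: spare_edges_def)
  moreover have "full_edges \<subseteq> {attached}" using full_edge_eq_attached by blast
  then have "card full_edges \<le> 1" using card_mono[of "{attached}" full_edges] by simp
  ultimately show ?thesis by simp
qed simp

lemma card_edges_split:
  "card E = card (edges_in U) + (\<Sum>w\<in>isolated. deg U w)
    + (card (edges_in attached) + (\<Sum>w\<in>attached. deg U w))
    + (card (edges_in detached) + (\<Sum>w\<in>detached. deg attached w))"
proof -
  have "V = U \<union> W" "U \<inter> W = {}" using U_subset by auto
  then have "card E = card (edges_in U) + card (edges_in W) + (\<Sum>w\<in>W. deg U w)"
    using card_edges_in_Un[of U W] edges_in_V by simp
  moreover have "edges_in W = edges_in (attached \<union> detached)"
  proof (intro equalityI subsetI)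
    fix e assume "e \<in> edges_in W"
    then obtain x y where "e = {x, y}" "x \<in> W" "y \<in> W" "adj x y" by (rule edges_inE)
    then show "e \<in> edges_in (attached \<union> detached)"
      using nonisolatedI[of x y] nonisolatedI[of y x] mem_edges_in adj_sym by blast
  qed (use edges_in_mono[of "attached \<union> detached" W] in \<open>auto simp: attached_def detached_def\<close>)
  moreover have "card (edges_in (attached \<union> detached))
      = card (edges_in attached) + card (edges_in detached) + (\<Sum>w\<in>detached. deg attached w)"
    using W_parts(3) by (intro card_edges_in_Un) auto
  moreover have "(\<Sum>w\<in>W. deg U w) = (\<Sum>w\<in>isolated. deg U w) + (\<Sum>w\<in>attached \<union> detached. deg U w)"
    by (subst W_parts(1), rule sum.union_disjoint) (use W_parts(2) in auto)
  moreover have "(\<Sum>w\<in>attached \<union> detached. deg U w)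
      = (\<Sum>w\<in>attached. deg U w) + (\<Sum>w\<in>detached. deg U w)"
    using W_parts(3) by (intro sum.union_disjoint) auto
  moreover have "(\<Sum>w\<in>detached. deg U w) = 0" by (simp add: detached_def)
  ultimately show ?thesis by simp
qed

text \<open>The edges inside \<open>attached\<close> are pairwise disjoint, and one that is not full is paid for by an
  endpoint missing a vertex of \<open>U\<close>.\<close>

lemma attached_count_le:
  "card (edges_in attached) + (\<Sum>w\<in>attached. deg U w) \<le> k * card attached + card full_edges"
proof -
  define deficient where "deficient = {w \<in> attached. deg U w < k}"
  have "\<exists>w \<in> e. w \<in> deficient" if e: "e \<in> edges_in attached - full_edges" for e
  proof (rule ccontr)
    assume no: "\<not> ?thesis"
    have "e \<subseteq> attached" using e by (auto simp: edges_in_def)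
    then have "deg U w = k" if "w \<in> e" for w
      using no that deg_U_le[of w] by (auto simp: deficient_def)
    then have "joined e U" using deg_eq_card_iff[of U] card_U by (auto simp: joined_def)
    moreover have "e \<in> edges_in W" using e edges_in_mono[of attached W] by (auto simp: attached_def)
    ultimately show False using e by (simp add: full_edges_def)
  qed
  then obtain g where g: "g e \<in> e \<and> g e \<in> deficient" if "e \<in> edges_in attached - full_edges" for e
    by metis
  have "inj_on g (edges_in attached - full_edges)"
    by (rule inj_onI) (metis DiffD1 attached_edges_disjoint g)
  then have "card (edges_in attached - full_edges) \<le> card deficient"
    using g by (intro card_inj_on_le[of g]) (auto simp: deficient_def)
  moreover have "card (edges_in attached) \<le> card (edges_in attached - full_edges) + card full_edges"
    using diff_card_le_card_Diff[of full_edges "edges_in attached"] by (simp add: full_edges_def)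
  moreover have "card deficient + (\<Sum>w\<in>attached. deg U w) \<le> k * card attached"
  proof -
    have "card deficient = (\<Sum>w\<in>attached. if deg U w < k then 1 else 0)"
      unfolding deficient_def by (simp add: sum.If_cases Collect_conj_eq)
    then have "card deficient + (\<Sum>w\<in>attached. deg U w)
        = (\<Sum>w\<in>attached. (if deg U w < k then 1 else 0) + deg U w)"
      by (simp add: sum.distrib)
    also have "\<dots> \<le> (\<Sum>w\<in>attached. k)" by (rule sum_mono) (use deg_U_le in auto)
    finally show ?thesis by (simp add: mult.commute)
  qed
  ultimately show ?thesis by linarith
qed

lemma detached_count_less:
  assumes "detached \<noteq> {}"
  shows "card (edges_in detached) + (\<Sum>w\<in>detached. deg attached w) < k * card detached"
proof -
  obtain w where "w \<in> detached" using assms by blast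
  then obtain y where "w \<in> W" "y \<in> W" "adj w y" unfolding detached_def nbhd_def by blast
  then have "path_in W [w, y]" by (auto simp: path_Cons)
  then have "b \<noteq> 2" using W_path_free by (auto simp: path_free_def)
  then have "b < 2 * k" using core_size_bounds(4) two_le_b by linarith
  have "deg attached w \<le> 1" if "w \<in> detached" for w
  proof -
    have "x = x'" if "x \<in> nbhd attached w" "x' \<in> nbhd attached w" for x x'
      using no_attached_P3[of x w x'] that \<open>w \<in> detached\<close>
      by (auto simp: adj_commute attached_def detached_def)
    then show ?thesis by (simp add: card_le_Suc0_iff_eq)
  qed
  then have cross: "(\<Sum>w\<in>detached. deg attached w) \<le> card detached"
    using sum_mono[of detached "deg attached" "\<lambda>_. 1"] by simp
  have "detached \<subseteq> W" by (auto simp: detached_def)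
  then have "2 * card (edges_in detached) \<le> (b - 2) * card detached"
    by (intro Erdos_Gallai path_free_subset[OF W_path_free]) simp_all
  moreover have "(b - 2) * card detached + 2 * card detached = b * card detached"
    using two_le_b by (metis distrib_right le_add_diff_inverse2)
  moreover have "b * card detached < 2 * k * card detached"
    using \<open>b < 2 * k\<close> assms by (intro mult_less_mono1) (auto simp: card_gt_0_iff)
  ultimately show ?thesis using cross by linarith
qed

lemma card_W_split: "card V - k = card isolated + card attached + card detached"
proof -
  have "card V - k = card W" using card_Diff_subset[of U V] U_subset card_U by simp
  also have "\<dots> = card isolated + (card attached + card detached)"
    by (subst W_parts(1)) (use W_parts(2,3) in \<open>simp add: card_Un_disjoint\<close>)
  finally show ?thesis by simp
qed

lemma card_edges_le: "card E \<le> extremal_size a b (card V)"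
  and extremal_joined: "card E = extremal_size a b (card V) \<Longrightarrow>
    card (edges_in U) = k choose 2 \<and> joined W U"
proof -
  have size: "extremal_size a b (card V) = (k choose 2)
      + (k * card isolated + k * card attached + k * card detached) + spare_edges a b"
    by (simp add: extremal_size_def card_W_split distrib_left)
  have iso: "(\<Sum>w\<in>isolated. deg U w) \<le> k * card isolated"
    using sum_deg_le[of U isolated] card_U by simp
  have core: "card (edges_in U) \<le> k choose 2" using card_edges_in_le_choose[of U] card_U by simp
  have det: "card (edges_in detached) + (\<Sum>w\<in>detached. deg attached w) \<le> k * card detached"
    using detached_count_less by (cases "detached = {}") auto
  note bounds = card_edges_split size iso core det attached_count_le card_full_edges_le
  show "card E \<le> extremal_size a b (card V)" using bounds by linarith
  assume extremal: "card E = extremal_size a b (card V)"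
  have "(\<Sum>w\<in>isolated. deg U w) = k * card isolated" using bounds extremal by linarith
  then have "joined isolated U" using sum_deg_eq_iff[of isolated U] card_U by simp
  moreover have "joined attached U"
  proof (cases "even a \<or> even b")
    case True
    then show ?thesis using attached_empty by (simp add: joined_def)
  next
    case False
    have "card full_edges = spare_edges a b" using bounds extremal by linarith
    then have "full_edges \<noteq> {}" using False by (auto simp: spare_edges_def)
    then show ?thesis using full_edge_eq_attached by (auto simp: full_edges_def)
  qed
  moreover have "detached = {}"
  proof (rule ccontr)
    assume "detached \<noteq> {}"
    then show False using detached_count_less bounds extremal by linarith
  qed
  ultimately have "joined W U" unfolding W_parts(1) by (auto simp: joined_def)
  moreover have "card (edges_in U) = k choose 2" using bounds extremal by linarith
  ultimately show "card (edges_in U) = k choose 2 \<and> joined W U" by simp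
qed

lemma extremal_clique_join:
  assumes "card E = extremal_size a b (card V)"
  shows "\<exists>D. clique_join V E U D \<and> card D = 2 * spare_edges a b"
proof -
  have U: "card (edges_in U) = k choose 2" and WU: "joined W U"
    using extremal_joined[OF assms] by auto
  have "(\<Sum>w\<in>W. deg U w) = k * (card V - k)"
    using sum_deg_eq_iff[of W U] WU card_Diff_subset[of U V] U_subset card_U by simp
  moreover have "U \<union> W = V" "U \<inter> W = {}" using U_subset by auto
  then have "card E = card (edges_in U) + card (edges_in W) + (\<Sum>w\<in>W. deg U w)"
    using card_edges_in_Un[of U W] edges_in_V by simp
  ultimately have W_edges: "card (edges_in W) = spare_edges a b"
    using assms U unfolding extremal_size_def by linarith
  then have "card (edges_in W) \<le> 1" by (simp add: spare_edges_def)
  then obtain D where D: "D \<subseteq> W" "card D = 2 * spare_edges a b"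
    and adj_W: "\<And>x y. x \<in> W \<Longrightarrow> y \<in> W \<Longrightarrow> adj x y \<longleftrightarrow> {x, y} = D"
    using obtain_single_edge[of W] finite_parts(2) unfolding W_edges by blast
  have "{x, y} \<in> E \<longleftrightarrow> x \<noteq> y \<and> (x \<in> U \<or> y \<in> U \<or> {x, y} = D)" if "x \<in> V" "y \<in> V" for x y
  proof -
    consider "x \<in> U" "y \<in> U" | "x \<in> U" "y \<in> W" | "x \<in> W" "y \<in> U" | "x \<in> W" "y \<in> W"
      using \<open>x \<in> V\<close> \<open>y \<in> V\<close> by blast
    then have "adj x y \<longleftrightarrow> x \<noteq> y \<and> (x \<in> U \<or> y \<in> U \<or> {x, y} = D)"
    proof cases
      case 1
      have "\<forall>x\<in>U. \<forall>y\<in>U. x \<noteq> y \<longrightarrow> adj x y"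
        using card_edges_in_eq_choose_iff[of U] U card_U by simp
      then show ?thesis using 1 by auto
    next
      case 4
      then show ?thesis using adj_W[of x y] by auto
    qed (use WU in \<open>auto simp: joined_def intro: adj_sym\<close>)
    then show ?thesis unfolding adj_def .
  qed
  then have "clique_join V E U D" using U_subset D(1) by (simp add: clique_join_def)
  then show ?thesis using D(2) by blast
qed

end

theorem (in two_path_free) card_edges_le_extremal:
  assumes large: "24 * (a * (a choose (a div 2)))\<^sup>2 \<le> card V"
  shows "card E \<le> extremal_size a b (card V)"
    and "card E = extremal_size a b (card V) \<Longrightarrow>
      \<exists>U D. clique_join V E U D \<and> card U = k \<and> card D = 2 * spare_edges a b"
proof -
  have extremal: "card E = extremal_size a b (card V) \<and>
      (\<exists>U D. clique_join V E U D \<and> card U = k \<and> card D = 2 * spare_edges a b)"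
    if ge: "extremal_size a b (card V) \<le> card E"
  proof -
    have "k * card V \<le> k * (card V - k + k)" by (intro mult_le_mono2) linarith
    then have "k * card V \<le> card E + k * k"
      using ge unfolding extremal_size_def distrib_left by linarith
    then obtain U X where "U \<subseteq> V" "card U = k" "X \<subseteq> V" "joined U X" "4 * a \<le> card X"
      using exists_joined_core[OF large] by blast
    then interpret two_path_free_core V E a b U X by unfold_locales
    have "card E = extremal_size a b (card V)" using card_edges_le ge by linarith
    then show ?thesis using extremal_clique_join card_U by blast
  qed
  show "card E \<le> extremal_size a b (card V)" using extremal by linarith
  show "\<exists>U D. clique_join V E U D \<and> card U = k \<and> card D = 2 * spare_edges a b"
    if "card E = extremal_size a b (card V)"
    using extremal that by simp
qed

section \<open>The extremal graph\<close>

lemma (in sgraph) card_edges_in_clique_join: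
  assumes fin: "finite V" and join: "clique_join V E U D" and D: "card D = 2 * m" "m \<le> 1"
  shows "card (edges_in V) = (card U choose 2) + card U * card (V - U) + m"
proof -
  have UV: "U \<subseteq> V" "D \<subseteq> V - U" using join by (auto simp: clique_join_def)
  have adj: "adj x y \<longleftrightarrow> x \<noteq> y \<and> (x \<in> U \<or> y \<in> U \<or> {x, y} = D)" if "x \<in> V" "y \<in> V" for x y
    using join that by (auto simp: clique_join_def adj_def)
  have finU: "finite U" using UV(1) fin by (rule finite_subset)
  have "U \<union> (V - U) = V" using UV(1) by blast
  then have "card (edges_in V) = card (edges_in U) + card (edges_in (V - U)) + (\<Sum>x\<in>V - U. deg U x)"
    using card_edges_in_Un[of U "V - U"] fin finU by simp
  moreover have "card (edges_in U) = card U choose 2"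
    using card_edges_in_eq_choose_iff[OF finU] adj UV(1) by blast
  moreover have "joined (V - U) U" using adj UV(1) unfolding joined_def by blast
  then have "(\<Sum>x\<in>V - U. deg U x) = card U * card (V - U)"
    using sum_deg_eq_iff[of "V - U" U] fin finU by simp
  moreover have "card (edges_in (V - U)) = m"
  proof (rule card_edges_in_single_edge[OF finite_Diff[OF fin] UV(2) D])
    fix x y assume xy: "x \<in> V - U" "y \<in> V - U"
    have "card {x} \<noteq> 2 * m" using D(2) by (cases m) auto
    then have "{x, y} = D \<Longrightarrow> x \<noteq> y" using D(1) by auto
    then show "adj x y \<longleftrightarrow> {x, y} = D" using adj[of x y] xy by auto
  qed
  ultimately show ?thesis by linarith
qed

lemma clique_join_graph_iso:
  assumes join: "clique_join V E U D" "clique_join V' E' U' D'"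
    and fin: "finite V" "finite V'"
    and card: "card V = card V'" "card U = card U'" "card D = card D'"
  shows "graph_iso V E V' E'"
proof -
  have sub: "U \<subseteq> V" "D \<subseteq> V - U" "U' \<subseteq> V'" "D' \<subseteq> V' - U'" using join by (auto simp: clique_join_def)
  obtain f where f: "bij_betw f V V'" "f ` U = U'" "f ` D = D'"
    using bij_betw_with_parts[OF fin card sub] .
  have inj: "inj_on f V" and img: "f ` V = V'" using f(1) by (auto simp: bij_betw_def)
  have "{x, y} \<in> E \<longleftrightarrow> {f x, f y} \<in> E'" if xy: "x \<in> V" "y \<in> V" for x y
  proof -
    have "f z \<in> U' \<longleftrightarrow> z \<in> U" if "z \<in> V" for z
      using inj_on_image_mem_iff[OF inj that sub(1)] f(2) by simp
    moreover have "{f x, f y} = D' \<longleftrightarrow> {x, y} = D"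
      using inj_on_image_eq_iff[OF inj, of "{x, y}" D] xy sub(2) f(3) by auto
    moreover have "f x = f y \<longleftrightarrow> x = y" using inj xy by (rule inj_on_eq_iff)
    moreover have "f x \<in> V'" "f y \<in> V'" using img xy by auto
    ultimately show ?thesis using join xy unfolding clique_join_def by simp
  qed
  then show ?thesis unfolding graph_iso_def using f(1) by blast
qed

lemma sgraph_GF: "sgraph (GF_E a b n)"
  by unfold_locales (auto simp: GF_E_def Let_def)

lemma clique_join_GF:
  assumes "Suc (core_size a b) < n"
  obtains U D where "clique_join (GF_V n) (GF_E a b n) U D"
    "card U = core_size a b" "card D = 2 * spare_edges a b"
proof
  let ?k = "core_size a b"
  let ?D = "if odd a \<and> odd b then {?k, Suc ?k} else {}"
  have pair: "{x, y} \<in> {{u, v} | u v. P u v} \<longleftrightarrow> P x y \<or> P y x" for x y :: nat and P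
    by (auto simp: doubleton_eq_iff)
  have "{x, y} \<in> GF_E a b n \<longleftrightarrow> x \<noteq> y \<and> (x < ?k \<or> y < ?k \<or> {x, y} = ?D)" if "x < n" "y < n" for x y
    using that unfolding GF_E_def Let_def core_size_def[symmetric] pair
    by (auto simp: doubleton_eq_iff)
  then show "clique_join (GF_V n) (GF_E a b n) {0..<?k} ?D"
    using assms by (auto simp: clique_join_def GF_V_def)
  show "card {0..<?k} = ?k" "card ?D = 2 * spare_edges a b" by (auto simp: spare_edges_def)
qed

lemma card_GF_E:
  assumes "Suc (core_size a b) < n"
  shows "card (GF_E a b n) = extremal_size a b n"
proof -
  interpret sgraph "GF_E a b n" by (rule sgraph_GF)
  obtain U D where join: "clique_join (GF_V n) (GF_E a b n) U D"
    and card: "card U = core_size a b" "card D = 2 * spare_edges a b"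
    using clique_join_GF[OF assms] .
  have "U \<subseteq> GF_V n" using join by (simp add: clique_join_def)
  then have "card (GF_V n - U) = n - core_size a b"
    using card(1) by (simp add: card_Diff_subset finite_subset GF_V_def)
  moreover have "e \<subseteq> GF_V n" if "e \<in> GF_E a b n" for e
    using that by (auto simp: GF_V_def GF_E_def Let_def)
  then have "edges_in (GF_V n) = GF_E a b n" by (auto simp: edges_in_def)
  ultimately show ?thesis
    using card_edges_in_clique_join[OF _ join card(2)] card(1)
    by (simp add: GF_V_def spare_edges_def extremal_size_def)
qed

lemma order_large:
  fixes a b n :: nat
  assumes "2 \<le> b" "b < a" "(a choose (a div 2))^2 * a^4 * b^4 \<le> n"
  shows "24 * (a * (a choose (a div 2)))\<^sup>2 \<le> n" "Suc (core_size a b) < n"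
proof -
  let ?C = "a choose (a div 2)"
  have "9 \<le> a\<^sup>2" using power_mono[of 3 a 2] assms by simp
  moreover have "16 \<le> b ^ 4" using power_mono[of 2 b 4] assms by simp
  ultimately have "9 * 16 \<le> a\<^sup>2 * b ^ 4" by (rule mult_le_mono)
  then have "24 * (a * ?C)\<^sup>2 \<le> (a\<^sup>2 * b ^ 4) * (a * ?C)\<^sup>2" by (intro mult_le_mono1) simp
  also have "\<dots> = ?C\<^sup>2 * a ^ 4 * b ^ 4"
    by (simp add: power_mult_distrib power2_eq_square power4_eq_xxxx)
  finally show large: "24 * (a * ?C)\<^sup>2 \<le> n" using assms(3) by simp
  have "a * 1 \<le> a * ?C" by (intro mult_le_mono2) (simp add: Suc_le_eq)
  also have "\<dots> \<le> (a * ?C)\<^sup>2" by (rule self_le_power) (use assms in \<open>auto simp: Suc_le_eq\<close>)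
  finally have "24 * a \<le> n" using large by linarith
  moreover have "core_size a b < a" using assms by (simp add: core_size_def)
  ultimately show "Suc (core_size a b) < n" using assms by linarith
qed

theorem theorem2p2:
  fixes a b n :: nat and V :: "'a set" and E :: "'a set set"
  assumes "2 \<le> b" and "b < a"
    and "simple_graph V E" and "card V = n"
    and "\<not> contains_subgraph (two_paths_V a b) (two_paths_E a b) V E"
    and "n \<ge> (a choose (a div 2))^2 * a^4 * b^4"
  shows "card E \<le> card (GF_E a b n) \<and>
         (card E = card (GF_E a b n) \<longrightarrow> graph_iso V E (GF_V n) (GF_E a b n))"
proof -
  interpret two_path_free V E a b using assms by unfold_locales
  note large = order_large[OF assms(1,2,6)]
  have GF: "card (GF_E a b n) = extremal_size a b (card V)"
    using card_GF_E[OF large(2)] assms(4) by simp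
  have "graph_iso V E (GF_V n) (GF_E a b n)" if extremal: "card E = card (GF_E a b n)"
  proof -
    obtain U D where "clique_join V E U D" "card U = k" "card D = 2 * spare_edges a b"
      using card_edges_le_extremal(2) large(1) extremal assms(4) unfolding GF by blast
    moreover obtain U' D' where "clique_join (GF_V n) (GF_E a b n) U' D'"
      "card U' = k" "card D' = 2 * spare_edges a b"
      using clique_join_GF[OF large(2)] .
    ultimately show ?thesis
      using clique_join_graph_iso[of V E U D "GF_V n"] finite_V assms(4) by (simp add: GF_V_def)
  qed
  then show ?thesis using card_edges_le_extremal(1) large(1) assms(4) unfolding GF by blast
qed

end
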